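(* Let $A:\Sigma\to\mathbb{R}$ be a Hölder potential whose maximizing probability $\mu_{\infty,A}$ is unique, let $W$ be a Hölder involution kernel for $A$ with dual potential $A^*$, let $\mu_{\infty,A^*}$ be the maximizing probability of $A^*$, let $V,V^*$ be the calibrated subactions of $A,A^*$ given by the zero-temperature limits, $I$ the deviation function and $\gamma$ the normalizing constant (all defined in the context), and let $c(x,y)=I(x)-W(x,y)+\gamma$. Then $(-V,-V^* )$ is an optimal pair for the Kantorovich dual problem with cost $c$ and marginals $\mu_{\infty,A},\mu_{\infty,A^*}$. That is: (1) (admissibility) for every $y\in\Sigma^*$, $\;-V^*(y)=\min_{x\in\Sigma}\{V(x)+c(x,y)\}$; (2) (optimality) for every continuous $f:\Sigma\to\mathbb{R}$, with $f^\#(y)=\min_{x\in\Sigma}\{-f(x)+c(x,y)\}$, $$\int f\,d\mu_{\infty,A}+\int f^\#\,d\mu_{\infty,A^*}\;\le\;\int (-V)\,d\mu_{\infty,A}+\int(-V^* )\,d\mu_{\infty,A^*}.$$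
   Context: $\Sigma=\{1,\dots,d\}^{\mathbb{N}}$ is the full one-sided shift space, with points $x=(x_0,x_1,\dots)$, metric $d(x,x')=\lambda^{\min\{j:x_j\ne x'_j\}}$ for a fixed $\lambda\in(0,1)$, and shift $\sigma(x_0,x_1,\dots)=(x_1,x_2,\dots)$. A second copy $\Sigma^*$ of $\Sigma$ has points $y=(y_0,y_1,\dots)$ and shift $\sigma^*(y_0,y_1,\dots)=(y_1,y_2,\dots)$. $\hat\Sigma=\Sigma\times\Sigma^*$ (points $(x,y)$), and $\tau_y(x)=(y_0,x_0,x_1,\dots)$. For continuous $A$, $m(A)=\max\{\int A\,d\nu:\nu\ \text{a }\sigma\text{-invariant Borel probability}\}$; an invariant probability attaining the maximum is maximizing for $A$. The same definitions are used for $A^*$ and $\sigma^*$. A continuous $W:\hat\Sigma\to\mathbb{R}$ is an involution kernel for $A$ if $A(\tau_y(x))+W(\tau_y(x),\sigma^*(y))-W(x,y)$ does not depend on $x$; this function of $y$ is the dual potential $A^*(y)$. A Hölder $A$ has a Hölder involution kernel, and then $A^*$ is Hölder; if $A$ has a unique maximizing probability then so does $A^*$, and $m(A)=m(A^* )$. For $\beta>0$ the Ruelle operator is $\mathcal{L}_{\beta A}\phi(x)=\sum_{\sigma(z)=x}e^{\beta A(z)}\phi(z)$ on continuous functions. $\nu_{\beta A}$ is the eigenprobability of its dual $\mathcal{L}_{\beta A}^*$ for the leading eigenvalue (the spectral radius), and $\phi_{\beta A}>0$ is the corresponding continuous eigenfunction of $\mathcal{L}_{\beta A}$, normalized by $\int\phi_{\beta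 A}\,d\nu_{\beta A}=1$. Analogously one has $\nu_{\beta A^*},\phi_{\beta A^*}$ for $\beta A^*$ and $\sigma^*$. Under the present assumptions the following limits exist (the first two uniformly): $$V(x)=\lim_{\beta\to\infty}\tfrac1\beta\log\phi_{\beta A}(x),\qquad V^*(y)=\lim_{\beta\to\infty}\tfrac1\beta\log\phi_{\beta A^*}(y),$$ $$\gamma=\lim_{\beta\to\infty}\tfrac1\beta\log\iint e^{\beta W(x,y)}\,d\nu_{\beta A}(x)\,d\nu_{\beta A^*}(y).$$ $V$ is a calibrated subaction for $A$, i.e. a continuous function with $V(x)=\max_{\sigma(z)=x}\{V(z)+A(z)-m(A)\}$, and likewise $V^*$ for $A^*$; these are unique up to additive constants. The deviation function $I:\Sigma\to[0,\infty]$ is $$I(x)=\sum_{n=0}^\infty\big[V\circ\sigma-V-A+m(A)\big](\sigma^n(x)),$$ which is lower semicontinuous. A pair $(f,f^\#)$, with $f:\Sigma\to\mathbb{R}$ continuous, is $c$-admissible if $f^\#(y)=\min_{x}\{-f(x)+c(x,y)\}$ for all $y$. The Kantorovich dual problem is to maximize $\int f\,d\mu_{\infty,A}+\int f^\#\,d\mu_{\infty,A^*}$ over admissible pairs, and an optimal pair is an admissible pair attaining the maximum. *)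

theory Defs
  imports "HOL-Probability.Probability"
begin

section \<open>The full one-sided shift\<close>

text \<open>
  The shift space \<open>{1,...,d}\<^sup>\<nat>\<close> is the type \<open>nat \<Rightarrow> 'a\<close>, where \<open>'a\<close> is a finite discrete alphabet
  with \<open>d = CARD('a)\<close> letters. Continuity and Borel sets refer to the library's product topology;
  \<open>open_iff_shift_dist\<close> below shows that \<open>shift_dist lam\<close> induces this topology.
  The second copy of the shift space is the same type.
\<close>

definition shift :: "(nat \<Rightarrow> 'a) \<Rightarrow> nat \<Rightarrow> 'a"
  where "shift x = (\<lambda>n. x (Suc n))"

definition tau :: "(nat \<Rightarrow> 'a) \<Rightarrow> (nat \<Rightarrow> 'a) \<Rightarrow> nat \<Rightarrow> 'a"
  where "tau y x = case_nat (y 0) x"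

definition shift_dist :: "real \<Rightarrow> (nat \<Rightarrow> 'a) \<Rightarrow> (nat \<Rightarrow> 'a) \<Rightarrow> real"
  where "shift_dist lam x x' = (if x = x' then 0 else lam ^ (LEAST j. x j \<noteq> x' j))"

definition shift_dist2 ::
    "real \<Rightarrow> (nat \<Rightarrow> 'a) \<times> (nat \<Rightarrow> 'a) \<Rightarrow> (nat \<Rightarrow> 'a) \<times> (nat \<Rightarrow> 'a) \<Rightarrow> real"
  where "shift_dist2 lam p q =
    max (shift_dist lam (fst p) (fst q)) (shift_dist lam (snd p) (snd q))"

definition hoelder :: "('b \<Rightarrow> 'b \<Rightarrow> real) \<Rightarrow> ('b \<Rightarrow> real) \<Rightarrow> bool"
  where "hoelder D f \<longleftrightarrow>
    (\<exists>C \<alpha>. 0 < \<alpha> \<and> \<alpha> \<le> 1 \<and> (\<forall>x y. \<bar>f x - f y\<bar> \<le> C * D x y powr \<alpha>))"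

lemma shift_dist_less_power_iff:
  assumes "0 < lam" "lam < 1"
  shows "shift_dist lam x y < lam ^ n \<longleftrightarrow> (\<forall>j\<le>n. x j = y j)"
proof (cases "x = y")
  case True
  then show ?thesis using assms by (simp add: shift_dist_def)
next
  case False
  then obtain k where "x k \<noteq> y k" by blast
  then have L: "x (LEAST j. x j \<noteq> y j) \<noteq> y (LEAST j. x j \<noteq> y j)"
    by (rule LeastI)
  have "shift_dist lam x y < lam ^ n \<longleftrightarrow> n < (LEAST j. x j \<noteq> y j)"
    using False assms by (simp add: shift_dist_def)
  also have "\<dots> \<longleftrightarrow> (\<forall>j\<le>n. x j = y j)"
    using L not_less_Least[of _ "\<lambda>j. x j \<noteq> y j"] by (meson leI le_less_trans)
  finally show ?thesis .
qed

lemma open_cylinder: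
  fixes x :: "nat \<Rightarrow> 'a::discrete_topology"
  shows "open {y. \<forall>j\<le>n. x j = y j}"
proof -
  have "{y. \<forall>j\<le>n. x j = y j} = Pi\<^sub>E UNIV (\<lambda>j. if j \<le> n then {x j} else UNIV)"
    by (auto simp: PiE_def Pi_def split: if_splits)
  moreover have "open (Pi\<^sub>E UNIV (\<lambda>j. if j \<le> n then {x j} else (UNIV :: 'a set)))"
  proof (rule open_PiE)
    show "finite {i. (if i \<le> n then {x i} else UNIV) \<noteq> (UNIV :: 'a set)}"
      by (rule finite_subset[of _ "{..n}"]) auto
    show "open (if j \<le> n then {x j} else (UNIV :: 'a set))" for j
      by (rule Topological_Spaces.open_discrete)
  qed
  ultimately show ?thesis by simp
qed

lemma open_iff_shift_dist:
  fixes U :: "(nat \<Rightarrow> 'a::discrete_topology) set"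
  assumes lam: "0 < lam" "lam < 1"
  shows "open U \<longleftrightarrow> (\<forall>x\<in>U. \<exists>e>0. \<forall>y. shift_dist lam x y < e \<longrightarrow> y \<in> U)"
proof
  assume U: "open U"
  show "\<forall>x\<in>U. \<exists>e>0. \<forall>y. shift_dist lam x y < e \<longrightarrow> y \<in> U"
  proof
    fix x assume "x \<in> U"
    then obtain X where X: "x \<in> Pi\<^sub>E UNIV X" "finite {i. X i \<noteq> UNIV}" "Pi\<^sub>E UNIV X \<subseteq> U"
      using product_topology_open_contains_basis[of "\<lambda>_. euclidean" UNIV U x] U
      by (auto simp: open_fun_def)
    from X(2) obtain n where n: "{i. X i \<noteq> UNIV} \<subseteq> {..n}"
      by (metis finite_nat_iff_bounded_le)
    have "y \<in> U" if "shift_dist lam x y < lam ^ n" for y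
    proof -
      have eq: "x j = y j" if "j \<le> n" for j
        using that \<open>shift_dist lam x y < lam ^ n\<close> shift_dist_less_power_iff[OF lam] by blast
      have "y i \<in> X i" for i
      proof (cases "X i = UNIV")
        case False
        then have "i \<le> n" using n by auto
        then show ?thesis using eq[of i] X(1) PiE_mem[of x UNIV X i] by simp
      qed simp
      then show ?thesis using X(3) by auto
    qed
    then show "\<exists>e>0. \<forall>y. shift_dist lam x y < e \<longrightarrow> y \<in> U"
      using lam by (intro exI[of _ "lam ^ n"]) auto
  qed
next
  assume *: "\<forall>x\<in>U. \<exists>e>0. \<forall>y. shift_dist lam x y < e \<longrightarrow> y \<in> U"
  have "\<exists>T. open T \<and> x \<in> T \<and> T \<subseteq> U" if "x \<in> U" for x
  proof -
    obtain e where e: "e > 0" "\<And>y. shift_dist lam x y < e \<Longrightarrow> y \<in> U"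
      using * \<open>x \<in> U\<close> by blast
    obtain n where "lam ^ n < e"
      using real_arch_pow_inv[OF e(1) lam(2)] by blast
    then have "{y. \<forall>j\<le>n. x j = y j} \<subseteq> U"
      using e(2) shift_dist_less_power_iff[OF lam, of x] by (smt (verit) mem_Collect_eq subsetI)
    then show ?thesis using open_cylinder[of n x] by blast
  qed
  then show "open U" by (subst open_subopen) blast
qed


section \<open>Maximizing probabilities and involution kernels\<close>

definition invariant_prob :: "(nat \<Rightarrow> 'a::topological_space) measure \<Rightarrow> bool"
  where "invariant_prob \<nu> \<longleftrightarrow> prob_space \<nu> \<and> sets \<nu> = sets borel \<and> distr \<nu> borel shift = \<nu>"

definition max_mean :: "((nat \<Rightarrow> 'a::topological_space) \<Rightarrow> real) \<Rightarrow> real"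
  where "max_mean A = (SUP \<nu>\<in>{\<nu>. invariant_prob \<nu>}. \<integral>x. A x \<partial>\<nu>)"

definition maximizing ::
    "((nat \<Rightarrow> 'a::topological_space) \<Rightarrow> real) \<Rightarrow> (nat \<Rightarrow> 'a) measure \<Rightarrow> bool"
  where "maximizing A \<mu> \<longleftrightarrow> invariant_prob \<mu> \<and> (\<integral>x. A x \<partial>\<mu>) = max_mean A"

definition involution_kernel ::
    "((nat \<Rightarrow> 'a::topological_space) \<Rightarrow> real) \<Rightarrow> ((nat \<Rightarrow> 'a) \<times> (nat \<Rightarrow> 'a) \<Rightarrow> real) \<Rightarrow> bool"
  where "involution_kernel A W \<longleftrightarrow> continuous_on UNIV W \<and>
    (\<forall>y. \<exists>r. \<forall>x. A (tau y x) + W (tau y x, shift y) - W (x, y) = r)"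

definition dual_potential ::
    "((nat \<Rightarrow> 'a) \<Rightarrow> real) \<Rightarrow> ((nat \<Rightarrow> 'a) \<times> (nat \<Rightarrow> 'a) \<Rightarrow> real) \<Rightarrow> (nat \<Rightarrow> 'a) \<Rightarrow> real"
  where "dual_potential A W y =
    (THE r. \<forall>x. A (tau y x) + W (tau y x, shift y) - W (x, y) = r)"

lemma dual_potential_eq:
  assumes "involution_kernel A W"
  shows "dual_potential A W y = A (tau y x) + W (tau y x, shift y) - W (x, y)"
proof -
  obtain r where r: "\<And>x. A (tau y x) + W (tau y x, shift y) - W (x, y) = r"
    using assms by (auto simp: involution_kernel_def)
  then have "dual_potential A W y = r"
    unfolding dual_potential_def by (intro the_equality) auto
  then show ?thesis using r by simp
qed


section \<open>The Ruelle operator\<close>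

definition ruelle ::
    "((nat \<Rightarrow> 'a) \<Rightarrow> real) \<Rightarrow> ((nat \<Rightarrow> 'a) \<Rightarrow> real) \<Rightarrow> (nat \<Rightarrow> 'a) \<Rightarrow> real"
  where "ruelle B \<phi> x = (\<Sum>z | shift z = x. exp (B z) * \<phi> z)"

text \<open>
  The operator on the Banach space of continuous functions with the supremum norm. It is
  meaningful for continuous \<open>B\<close>, see \<open>apply_ruelle_op\<close>.
\<close>

definition ruelle_op ::
    "((nat \<Rightarrow> 'a::topological_space) \<Rightarrow> real) \<Rightarrow> ((nat \<Rightarrow> 'a) \<Rightarrow>\<^sub>C real) \<Rightarrow> ((nat \<Rightarrow> 'a) \<Rightarrow>\<^sub>C real)"
  where "ruelle_op B \<phi> = Bcontfun (ruelle B (apply_bcontfun \<phi>))"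

text \<open>On a real Banach space the spectral radius is given by Gelfand's formula.\<close>

definition spectral_radius :: "('b::real_normed_vector \<Rightarrow> 'b) \<Rightarrow> real"
  where "spectral_radius T = lim (\<lambda>n. root n (onorm (T ^^ n)))"

definition eigenprobability ::
    "((nat \<Rightarrow> 'a::topological_space) \<Rightarrow> real) \<Rightarrow> (nat \<Rightarrow> 'a) measure \<Rightarrow> bool"
  where "eigenprobability B \<nu> \<longleftrightarrow> prob_space \<nu> \<and> sets \<nu> = sets borel \<and>
    (\<forall>f. continuous_on UNIV f \<longrightarrow>
      (\<integral>x. ruelle B f x \<partial>\<nu>) = spectral_radius (ruelle_op B) * (\<integral>x. f x \<partial>\<nu>))"

definition normalized_eigenfunction ::
    "((nat \<Rightarrow> 'a::topological_space) \<Rightarrow> real) \<Rightarrow> (nat \<Rightarrow> 'a) measure \<Rightarrow> ((nat \<Rightarrow> 'a) \<Rightarrow> real) \<Rightarrow> bool"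
  where "normalized_eigenfunction B \<nu> \<phi> \<longleftrightarrow> continuous_on UNIV \<phi> \<and> (\<forall>x. 0 < \<phi> x) \<and>
    (\<forall>x. ruelle B \<phi> x = spectral_radius (ruelle_op B) * \<phi> x) \<and> (\<integral>x. \<phi> x \<partial>\<nu>) = 1"

lemma compact_UNIV_shift_space:
  "compact (UNIV :: (nat \<Rightarrow> 'a::{finite,discrete_topology}) set)"
proof -
  have "compact_space (product_topology (\<lambda>_. euclidean :: 'a topology) (UNIV :: nat set))"
    by (subst compact_space_product_topology)
       (auto simp: compact_space_def intro: finite_imp_compact)
  then show ?thesis
    by (simp add: euclidean_product_topology compact_space_def)
qed

lemma preimage_shift: "{z. shift z = x} = range (\<lambda>a. case_nat a x)"
proof -
  have "z = case_nat (z 0) x" if "shift z = x" for z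
    using that by (auto simp: shift_def fun_eq_iff split: nat.split)
  then show ?thesis by (auto simp: shift_def)
qed

lemma ruelle_eq_sum:
  "ruelle B \<phi> x = (\<Sum>a\<in>(UNIV :: 'a::finite set). exp (B (case_nat a x)) * \<phi> (case_nat a x))"
proof -
  have "inj (\<lambda>a::'a. case_nat a x)"
    by (rule injI) (metis nat.case(1))
  then show ?thesis
    unfolding ruelle_def preimage_shift by (subst sum.reindex) auto
qed

lemma apply_ruelle_op:
  fixes B :: "(nat \<Rightarrow> 'a::{finite,discrete_topology}) \<Rightarrow> real"
  assumes "continuous_on UNIV B"
  shows "apply_bcontfun (ruelle_op B \<phi>) = ruelle B (apply_bcontfun \<phi>)"
proof -
  have cons: "continuous_on UNIV (\<lambda>x :: nat \<Rightarrow> 'a. case_nat a x)" for a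
  proof (rule continuous_on_coordinatewise_then_product)
    fix i show "continuous_on UNIV (\<lambda>x :: nat \<Rightarrow> 'a. case_nat a x i)"
      by (cases i) (auto intro: continuous_on_product_coordinates)
  qed
  have comp: "continuous_on UNIV (\<lambda>x. g (case_nat a x))"
    if "continuous_on UNIV g" for g :: "(nat \<Rightarrow> 'a) \<Rightarrow> real" and a
    using continuous_on_compose2[OF that cons] by auto
  have "continuous_on UNIV (ruelle B (apply_bcontfun \<phi>))"
    unfolding ruelle_eq_sum by (intro continuous_intros comp assms) auto
  moreover from this have "bounded (range (ruelle B (apply_bcontfun \<phi>)))"
    by (intro compact_imp_bounded compact_continuous_image compact_UNIV_shift_space)
  ultimately show ?thesis
    unfolding ruelle_op_def by (subst Bcontfun_inverse) (auto simp: bcontfun_def)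
qed


section \<open>Deviation function and the dual transport problem\<close>

definition deviation ::
    "((nat \<Rightarrow> 'a::topological_space) \<Rightarrow> real) \<Rightarrow> ((nat \<Rightarrow> 'a) \<Rightarrow> real) \<Rightarrow> (nat \<Rightarrow> 'a) \<Rightarrow> ereal"
  where "deviation A V x =
    (\<Sum>n. let z = (shift ^^ n) x in ereal (V (shift z) - V z - A z + max_mean A))"

definition is_min_of :: "'b::order \<Rightarrow> 'b set \<Rightarrow> bool"
  where "is_min_of r S \<longleftrightarrow> r \<in> S \<and> (\<forall>s\<in>S. r \<le> s)"

text \<open>The cost may take the value \<open>\<infinity>\<close>.\<close>

definition c_admissible ::
    "('b::topological_space \<Rightarrow> 'c \<Rightarrow> ereal) \<Rightarrow> ('b \<Rightarrow> real) \<Rightarrow> ('c \<Rightarrow> real) \<Rightarrow> bool"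
  where "c_admissible c f g \<longleftrightarrow> continuous_on UNIV f \<and>
    (\<forall>y. is_min_of (ereal (g y)) (range (\<lambda>x. ereal (- f x) + c x y)))"

definition optimal_pair ::
    "('b::topological_space \<Rightarrow> 'c \<Rightarrow> ereal) \<Rightarrow> 'b measure \<Rightarrow> 'c measure \<Rightarrow>
      ('b \<Rightarrow> real) \<Rightarrow> ('c \<Rightarrow> real) \<Rightarrow> bool"
  where "optimal_pair c \<mu> \<mu>' f g \<longleftrightarrow> c_admissible c f g \<and>
    (\<forall>f' g'. c_admissible c f' g' \<longrightarrow>
      (\<integral>x. f' x \<partial>\<mu>) + (\<integral>y. g' y \<partial>\<mu>') \<le> (\<integral>x. f x \<partial>\<mu>) + (\<integral>y. g y \<partial>\<mu>'))"

end

theory Submission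
  imports Defs
begin

text \<open>
  The weights of Ruelle's operator turn into maxima as \<open>\<beta> \<rightarrow> \<infinity>\<close>, and the theorem is what remains of two
  identities at positive temperature.

  \<^bold>\<open>Admissibility.\<close> The cohomology equation of the kernel says that \<open>y \<mapsto> \<integral> exp (\<beta> W (x, y)) d\<nu>\<^sub>\<beta> x\<close> is a
  positive eigenfunction of the operator of \<open>\<beta> A*\<close> for the eigenvalue of \<open>\<beta> A\<close>
  (\<open>kernel_eigenfunction\<close>). Positive eigenfunctions are unique up to a factor, so this function is
  \<open>\<phi>*\<^sub>\<beta>\<close> up to the normalization that produces \<open>\<gamma>\<close>, and
  \<open>1/\<beta> ln \<integral> exp (\<beta> W (x, y)) d\<nu>\<^sub>\<beta> x\<close> tends to \<open>V* y + \<gamma>\<close>. On the other hand this integral obeys a Laplace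
  principle with limit \<open>max (W (x, y) - V x - I x)\<close> over \<open>x\<close>. To see this, apply the eigenmeasure
  equation \<open>k\<close> times. The integral becomes a mean, over the Gibbs state \<open>\<phi>\<^sub>\<beta> \<nu>\<^sub>\<beta>\<close>, of sums over preimages
  of order \<open>k\<close>, whose exponents, divided by \<open>\<beta>\<close>, converge uniformly to \<open>W - V - I\<^sub>k\<close> with \<open>I\<^sub>k\<close> the
  \<open>k\<close>-th partial sum of the deviation function. The maximal term gives the upper
  bound (\<open>kernel_le\<close>); compactness lets \<open>k\<close> tend to infinity. For the lower bound (\<open>kernel_ge\<close>) keep one branch, the one following a given \<open>x\<close> with
  \<open>I x < \<infinity>\<close>. It costs nothing on the exponential scale as soon as the Gibbs states charge a neighbourhood
  of the \<open>k\<close>-th iterate of \<open>x\<close>. This happens for some \<open>k\<close>, because the orbit of such an \<open>x\<close>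
  equidistributes with respect to \<open>\<mu>\<close> and the Gibbs states converge weakly to \<open>\<mu>\<close>.

  \<^bold>\<open>Optimality.\<close> Take \<open>y\<close> along whose orbit the inequality of the subaction \<open>V*\<close> is an equality, which is
  almost sure for the maximizing probability of \<open>A*\<close>, and let \<open>x\<close> attain the minimum in the admissibility equation for \<open>y\<close>. The kernel transports equality
  along the inverse of the natural extension, \<open>(x, y) \<mapsto> (tau y x, shift y)\<close>, so that
  \<open>c (x, y) \<le> - V x - V* y\<close> along this whole orbit (\<open>backward_orbit\<close>). For an admissible pair \<open>(f, g)\<close> this
  gives \<open>(f + V) (x\<^sub>n) + (g + V*) (y\<^sub>n) \<le> 0\<close>. The sequence of the \<open>x\<^sub>n\<close> equidistributes with respect to \<open>\<mu>\<close>,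
  and averaging over \<open>n\<close> and integrating over \<open>y\<close> yields
  \<open>\<integral> (f + V) d\<mu> + \<integral> (g + V*) d\<mu>* \<le> 0\<close>. In effect the orbit replaces an optimal transport plan.

  \<^bold>\<open>Uniqueness of the maximizing probability\<close> enters through a single compactness statement
  (\<open>states_tendsto_maximizing\<close>): asymptotically invariant averages that nearly maximize \<open>A\<close> converge to
  \<open>\<mu>\<close>. It serves the Gibbs states and both kinds of orbits. That Gibbs states nearly maximize \<open>A\<close> is
  an entropy bound (\<open>ln_eigenvalue_le_mean\<close>), which also shows that the pressures of \<open>\<beta> A\<close>, divided by
  \<open>\<beta>\<close>, tend to the maximal mean of \<open>A\<close>.
\<close>

section \<open>Cylinders and continuity on the shift space\<close>

definition cyl :: "nat \<Rightarrow> (nat \<Rightarrow> 'a) \<Rightarrow> (nat \<Rightarrow> 'a) set"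
  where "cyl n x = {y. \<forall>j<n. y j = x j}"

lemma mem_cyl: "y \<in> cyl n x \<longleftrightarrow> (\<forall>j<n. y j = x j)"
  by (simp add: cyl_def)

lemma self_mem_cyl [simp]: "x \<in> cyl n x"
  by (simp add: mem_cyl)

lemma cyl_antimono: "m \<le> n \<Longrightarrow> cyl n x \<subseteq> cyl m x"
  by (auto simp: mem_cyl)

lemma cyl_eq: "y \<in> cyl n x \<Longrightarrow> cyl n y = cyl n x"
  by (auto simp: mem_cyl)

lemma open_cyl [simp]: "open (cyl n (x :: nat \<Rightarrow> 'a::discrete_topology))"
proof (cases n)
  case 0
  then show ?thesis by (simp add: cyl_def)
next
  case (Suc m)
  then have "cyl n x = {y. \<forall>j\<le>m. x j = y j}"
    by (auto simp: cyl_def less_Suc_eq_le)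
  then show ?thesis using open_cylinder[of m x] by simp
qed

lemma closed_cyl [simp]: "closed (cyl n (x :: nat \<Rightarrow> 'a::discrete_topology))"
proof -
  have "- cyl n x = (\<Union>y \<in> - cyl n x. cyl n y)"
    by (auto simp: mem_cyl)
  moreover have "open (\<Union>y \<in> - cyl n x. cyl n y)"
    by (intro open_UN ballI open_cyl)
  ultimately show ?thesis unfolding closed_def by (simp only:)
qed

lemma finite_cyl_range: "finite (range (cyl n :: (nat \<Rightarrow> 'a::finite) \<Rightarrow> _))"
proof -
  define word where "word x = map x [0..<n]" for x :: "nat \<Rightarrow> 'a"
  have "finite (range word)"
    by (rule finite_subset[OF _ finite_lists_length_eq[of UNIV n]]) (auto simp: word_def)
  moreover have "cyl n x = (\<lambda>w. {y. \<forall>j<n. y j = w ! j}) (word x)" for x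
    by (auto simp: cyl_def word_def)
  then have "range (cyl n :: (nat \<Rightarrow> 'a) \<Rightarrow> _) = (\<lambda>w. {y. \<forall>j<n. y j = w ! j}) ` range word"
    by (auto simp: image_image)
  ultimately show ?thesis by simp
qed

lemma open_contains_cyl:
  fixes U :: "(nat \<Rightarrow> 'a::discrete_topology) set"
  assumes "open U" "x \<in> U"
  obtains n where "cyl n x \<subseteq> U"
proof -
  obtain e where e: "e > 0" "\<And>y. shift_dist (1/2) x y < e \<Longrightarrow> y \<in> U"
    using open_iff_shift_dist[of "1/2" U] assms by auto
  obtain n where n: "(1/2::real) ^ n < e"
    using real_arch_pow_inv[OF e(1), of "1/2"] by auto
  have "cyl (Suc n) x \<subseteq> U"
  proof
    fix y assume "y \<in> cyl (Suc n) x"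
    then have "shift_dist (1/2) x y < (1/2) ^ n"
      by (subst shift_dist_less_power_iff) (auto simp: mem_cyl)
    then show "y \<in> U" using e(2) n by (meson less_trans)
  qed
  then show thesis by (rule that)
qed

text \<open>
  By compactness a continuous function depends, up to a given error, only on finitely many
  coordinates. This is the form in which continuity is used below.
\<close>

lemma continuous_iff_cyl:
  fixes f :: "(nat \<Rightarrow> 'a::{finite,discrete_topology}) \<Rightarrow> real"
  shows "continuous_on UNIV f \<longleftrightarrow> (\<forall>e>0. \<exists>n. \<forall>x. \<forall>y\<in>cyl n x. \<bar>f y - f x\<bar> < e)"
proof (intro iffI allI impI)
  fix e :: real assume cont: "continuous_on UNIV f" and e: "e > 0"
  have "\<exists>n. \<forall>y\<in>cyl n x. \<bar>f y - f x\<bar> < e/2" for x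
  proof -
    have "open (f -` ball (f x) (e/2))"
      using cont by (auto intro: open_vimage)
    moreover have "x \<in> f -` ball (f x) (e/2)" using e by simp
    ultimately obtain n where "cyl n x \<subseteq> f -` ball (f x) (e/2)"
      by (rule open_contains_cyl)
    then show ?thesis by (intro exI[of _ n]) (auto simp: dist_real_def abs_minus_commute)
  qed
  then obtain n where n: "\<And>x y. y \<in> cyl (n x) x \<Longrightarrow> \<bar>f y - f x\<bar> < e/2" by metis
  obtain P where P: "finite P" "UNIV \<subseteq> (\<Union>p\<in>P. cyl (n p) p)"
  proof (rule compactE_image[OF compact_UNIV_shift_space])
    show "UNIV \<subseteq> (\<Union>p\<in>UNIV. cyl (n p) p)" using self_mem_cyl by blast
  qed auto
  define N where "N = Max (n ` P)"
  have "\<bar>f y - f x\<bar> < e" if "y \<in> cyl N x" for x y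
  proof -
    obtain p where p: "p \<in> P" "x \<in> cyl (n p) p" using P by blast
    then have "n p \<le> N" using P(1) by (auto simp: N_def)
    then have "y \<in> cyl (n p) p" using that p cyl_antimono[of "n p" N x] cyl_eq[of x "n p" p] by auto
    then show ?thesis using n[of y p] n[of x p] p by linarith
  qed
  then show "\<exists>n. \<forall>x. \<forall>y\<in>cyl n x. \<bar>f y - f x\<bar> < e" by blast
next
  assume *: "\<forall>e>0. \<exists>n. \<forall>x. \<forall>y\<in>cyl n x. \<bar>f y - f x\<bar> < e"
  show "continuous_on UNIV f"
    unfolding continuous_on_topological
  proof (intro ballI allI impI)
    fix x B assume "open B" "f x \<in> B"
    then obtain e where e: "e > 0" "ball (f x) e \<subseteq> B" by (meson open_contains_ball)
    obtain n where "\<And>y. y \<in> cyl n x \<Longrightarrow> \<bar>f y - f x\<bar> < e" using * e(1) by metis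
    then show "\<exists>A. open A \<and> x \<in> A \<and> (\<forall>y\<in>UNIV. y \<in> A \<longrightarrow> f y \<in> B)"
      using e(2) by (intro exI[of _ "cyl n x"]) (auto simp: dist_real_def abs_minus_commute subset_iff)
  qed
qed

lemma continuous_cylE:
  fixes f :: "(nat \<Rightarrow> 'a::{finite,discrete_topology}) \<Rightarrow> real"
  assumes "continuous_on UNIV f" "e > 0"
  obtains n where "\<And>x y. y \<in> cyl n x \<Longrightarrow> \<bar>f y - f x\<bar> < e"
  using assms unfolding continuous_iff_cyl by blast

lemma continuous_attains_min:
  fixes f :: "(nat \<Rightarrow> 'a::{finite,discrete_topology}) \<Rightarrow> real"
  assumes "continuous_on UNIV f"
  obtains x where "\<And>y. f x \<le> f y"
  using continuous_attains_inf[OF compact_UNIV_shift_space _ assms] by auto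

lemma continuous_abs_bound:
  fixes f :: "(nat \<Rightarrow> 'a::{finite,discrete_topology}) \<Rightarrow> real"
  assumes "continuous_on UNIV f"
  obtains K where "K > 0" "\<And>x. \<bar>f x\<bar> \<le> K"
proof -
  have "bounded (range f)"
    by (intro compact_imp_bounded compact_continuous_image assms compact_UNIV_shift_space)
  then show thesis using that unfolding bounded_pos by auto
qed

lemma continuous_on_case_nat:
  "continuous_on UNIV (\<lambda>x :: nat \<Rightarrow> 'a::discrete_topology. case_nat a x)"
proof (rule continuous_on_coordinatewise_then_product)
  fix i show "continuous_on UNIV (\<lambda>x :: nat \<Rightarrow> 'a. case_nat a x i)"
    by (cases i) (auto intro: continuous_on_product_coordinates)
qed

lemma continuous_on_shift: "continuous_on UNIV (shift :: (nat \<Rightarrow> 'a::topological_space) \<Rightarrow> _)"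
  unfolding shift_def
  by (intro continuous_on_coordinatewise_then_product continuous_on_product_coordinates)

lemma continuous_on_tau:
  "continuous_on UNIV (\<lambda>y :: nat \<Rightarrow> 'a::discrete_topology. tau y x)"
proof (rule continuous_on_coordinatewise_then_product)
  fix i show "continuous_on UNIV (\<lambda>y :: nat \<Rightarrow> 'a. tau y x i)"
    by (cases i) (auto simp: tau_def intro: continuous_on_product_coordinates)
qed

lemma continuous_on_shift_pow:
  "continuous_on UNIV ((shift :: (nat \<Rightarrow> 'a::topological_space) \<Rightarrow> _) ^^ n)"
proof (induction n)
  case 0
  then show ?case by (simp add: id_def)
next
  case (Suc n)
  then show ?case
    using continuous_on_compose[OF Suc continuous_on_subset[OF continuous_on_shift]] by (auto simp: o_def)
qed

lemma continuous_comp: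
  fixes f :: "(nat \<Rightarrow> 'a::discrete_topology) \<Rightarrow> real"
  assumes "continuous_on UNIV f"
  shows "continuous_on UNIV (\<lambda>x. f (shift x))" "continuous_on UNIV (\<lambda>x. f (case_nat a x))"
    "continuous_on UNIV (\<lambda>x. f ((shift ^^ n) x))" "continuous_on UNIV (\<lambda>y. f (tau y x))"
  using continuous_on_compose2[OF assms continuous_on_shift]
    continuous_on_compose2[OF assms continuous_on_case_nat]
    continuous_on_compose2[OF assms continuous_on_shift_pow]
    continuous_on_compose2[OF assms continuous_on_tau] by auto

lemma continuous_on_slice:
  fixes F :: "'b::topological_space \<times> 'c::topological_space \<Rightarrow> real"
  assumes "continuous_on UNIV F"
  shows "continuous_on UNIV (\<lambda>x. F (x, y))" "continuous_on UNIV (\<lambda>y. F (x, y))"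
  by (rule continuous_on_compose2[OF assms]; auto intro!: continuous_intros)+

lemma continuous_on_indicator_clopen:
  assumes "open C" "closed C"
  shows "continuous_on UNIV (indicator C :: 'b::topological_space \<Rightarrow> real)"
  unfolding continuous_on_topological
proof (intro ballI allI impI)
  fix x and B :: "real set" assume "indicator C x \<in> B"
  then show "\<exists>U. open U \<and> x \<in> U \<and> (\<forall>y\<in>UNIV. y \<in> U \<longrightarrow> indicator C y \<in> B)"
    using assms by (intro exI[of _ "if x \<in> C then C else - C"]) (auto simp: open_Compl)
qed

lemma shift_case_nat [simp]: "shift (case_nat a x) = x"
  by (simp add: shift_def)

lemma shift_tau [simp]: "shift (tau y x) = x"
  by (simp add: tau_def)

lemma shift_pow_nth: "(shift ^^ n) x j = x (n + j)"
  by (induction n arbitrary: j) (simp_all add: shift_def)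

lemma sets_borel_clopen:
  "sets (borel :: (nat \<Rightarrow> 'a::{finite,discrete_topology}) measure) =
    sigma_sets UNIV {C. open C \<and> closed C}"
proof
  have "U \<in> sigma_sets UNIV {C. open C \<and> closed C}" if "open U" for U :: "(nat \<Rightarrow> 'a) set"
  proof -
    define K where "K = {C \<in> (\<Union>n. range (cyl n)). C \<subseteq> U}"
    have "countable (\<Union>n. range (cyl n :: (nat \<Rightarrow> 'a) \<Rightarrow> _))"
      by (rule countable_UN[OF countableI_type countable_finite[OF finite_cyl_range]])
    then have K: "countable K"
      unfolding K_def by (rule countable_subset[OF Collect_restrict])
    have U: "\<Union>K = U"
    proof
      show "U \<subseteq> \<Union>K"
      proof
        fix x assume "x \<in> U"
        with that obtain n where "cyl n x \<subseteq> U" by (rule open_contains_cyl)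
        then show "x \<in> \<Union>K" unfolding K_def using self_mem_cyl[of x n] by blast
      qed
    qed (auto simp: K_def)
    have "C \<in> sigma_sets UNIV {C. open C \<and> closed C}" if "C \<in> K" for C
      using that by (intro sigma_sets.Basic) (auto simp: K_def)
    then have "\<Union>K \<in> sigma_sets UNIV {C. open C \<and> closed C}"
      by (rule sigma_sets_UNION[OF K])
    then show ?thesis by (simp only: U)
  qed
  then have "sigma_sets UNIV {S. open S} \<subseteq> sigma_sets UNIV {C::(nat \<Rightarrow> 'a) set. open C \<and> closed C}"
    by (intro sigma_sets_mono subsetI) simp
  moreover have borel: "sets (borel :: (nat \<Rightarrow> 'a) measure) = sigma_sets UNIV {S. open S}"
    by (simp add: borel_def)
  ultimately show "sets (borel :: (nat \<Rightarrow> 'a) measure) \<subseteq> sigma_sets UNIV {C. open C \<and> closed C}"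
    by (simp only:)
  show "sigma_sets UNIV {C::(nat \<Rightarrow> 'a) set. open C \<and> closed C} \<subseteq> sets borel"
    unfolding borel by (rule sigma_sets_mono') auto
qed

section \<open>Positive normalized functionals on continuous functions\<close>

text \<open>
  Probabilities are handled through their integrals of continuous functions, so that Gibbs means and
  empirical averages along orbits are objects of the same kind and no measurability has to be
  discussed.
\<close>

definition state :: "(((nat \<Rightarrow> 'a::topological_space) \<Rightarrow> real) \<Rightarrow> real) \<Rightarrow> bool"
  where "state E \<longleftrightarrow>
    (\<forall>f g. continuous_on UNIV f \<longrightarrow> continuous_on UNIV g \<longrightarrow> E (\<lambda>x. f x + g x) = E f + E g) \<and>
    (\<forall>c f. continuous_on UNIV f \<longrightarrow> E (\<lambda>x. c * f x) = c * E f) \<and>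
    (\<forall>f. continuous_on UNIV f \<longrightarrow> (\<forall>x. 0 \<le> f x) \<longrightarrow> 0 \<le> E f) \<and>
    E (\<lambda>_. 1) = 1"

lemma state_add:
  "state E \<Longrightarrow> continuous_on UNIV f \<Longrightarrow> continuous_on UNIV g \<Longrightarrow> E (\<lambda>x. f x + g x) = E f + E g"
  and state_scale: "state E \<Longrightarrow> continuous_on UNIV f \<Longrightarrow> E (\<lambda>x. c * f x) = c * E f"
  and state_nonneg: "state E \<Longrightarrow> continuous_on UNIV f \<Longrightarrow> (\<And>x. 0 \<le> f x) \<Longrightarrow> 0 \<le> E f"
  and state_one: "state E \<Longrightarrow> E (\<lambda>_. 1) = 1"
  by (simp_all add: state_def)

lemma state_const: "state E \<Longrightarrow> E (\<lambda>_. c) = c"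
  using state_scale[of E "\<lambda>_. 1" c] by (simp add: state_one)

lemma state_diff:
  assumes "state E" "continuous_on UNIV f" "continuous_on UNIV g"
  shows "E (\<lambda>x. f x - g x) = E f - E g"
proof -
  have "E (\<lambda>x. f x + (-1) * g x) = E f + (-1) * E g"
    using assms by (subst state_add) (auto intro!: continuous_intros simp only: state_scale)
  then show ?thesis by simp
qed

lemma state_mono:
  assumes "state E" "continuous_on UNIV f" "continuous_on UNIV g" "\<And>x. f x \<le> g x"
  shows "E f \<le> E g"
  using state_nonneg[OF assms(1), of "\<lambda>x. g x - f x"] state_diff[OF assms(1,3,2)] assms
  by (simp add: continuous_on_diff)

lemma state_le_const:
  assumes "state E" "continuous_on UNIV f" "\<And>x. f x \<le> K"
  shows "E f \<le> K"
  using state_mono[OF assms(1,2), of "\<lambda>_. K"] assms by (simp add: state_const)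

lemma state_abs_le:
  assumes "state E" "continuous_on UNIV f" "\<And>x. \<bar>f x\<bar> \<le> K"
  shows "\<bar>E f\<bar> \<le> K"
proof -
  have "E (\<lambda>x. 0 - f x) \<le> K"
    using assms by (intro state_le_const[OF assms(1)] continuous_intros) (auto simp: abs_le_iff)
  moreover have "E f \<le> K"
    using assms by (intro state_le_const[OF assms(1)]) (auto simp: abs_le_iff)
  ultimately show ?thesis
    using state_diff[OF assms(1) continuous_on_const[of UNIV 0] assms(2)] state_const[OF assms(1), of 0] by simp
qed

lemma state_sum:
  assumes "state E" "\<And>i. i \<in> I \<Longrightarrow> continuous_on UNIV (f i)"
  shows "E (\<lambda>x. \<Sum>i\<in>I. f i x) = (\<Sum>i\<in>I. E (f i))"
  using assms(2)
proof (induction I rule: infinite_finite_induct)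
  case (insert i I)
  then show ?case
    by (simp add: state_add[OF assms(1)] continuous_on_sum)
qed (use state_const[OF assms(1), of 0] in auto)

lemma integrable_continuous:
  fixes f :: "(nat \<Rightarrow> 'a::{finite,discrete_topology}) \<Rightarrow> real"
  assumes "prob_space \<nu>" "sets \<nu> = sets borel" "continuous_on UNIV f"
  shows "integrable \<nu> f"
proof -
  interpret prob_space \<nu> by fact
  obtain K where "\<And>x. \<bar>f x\<bar> \<le> K" using continuous_abs_bound[OF assms(3)] by metis
  moreover have "f \<in> borel_measurable \<nu>"
    using borel_measurable_continuous_onI[OF assms(3)] measurable_cong_sets[OF assms(2) refl] by blast
  ultimately show ?thesis by (intro integrable_const_bound[of _ K]) auto
qed

lemma state_integral:
  fixes \<nu> :: "(nat \<Rightarrow> 'a::{finite,discrete_topology}) measure"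
  assumes "prob_space \<nu>" "sets \<nu> = sets borel"
  shows "state (\<lambda>f. \<integral>x. f x \<partial>\<nu>)"
  unfolding state_def
  using integrable_continuous[OF assms] prob_space.prob_space[OF assms(1)] by auto

text \<open>
  Every continuous function is a uniform limit of linear combinations of indicators of cylinders.
\<close>

lemma state_eqI:
  fixes E E' :: "((nat \<Rightarrow> 'a::{finite,discrete_topology}) \<Rightarrow> real) \<Rightarrow> real"
  assumes E: "state E" "state E'" and f: "continuous_on UNIV f"
    and eq: "\<And>C. open C \<Longrightarrow> closed C \<Longrightarrow> E (indicator C) = E' (indicator C)"
  shows "E f = E' f"
proof -
  have "\<bar>E f - E' f\<bar> \<le> 2 * e" if e: "e > 0" for e :: real
  proof -
    obtain n where n: "\<And>x y. y \<in> cyl n x \<Longrightarrow> \<bar>f y - f x\<bar> < e"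
      using continuous_cylE[OF f e] by blast
    define r where "r C = (SOME x. x \<in> C)" for C :: "(nat \<Rightarrow> 'a) set"
    define g where "g = (\<lambda>x. \<Sum>C\<in>range (cyl n). f (r C) * indicator C x)"
    have summand: "continuous_on UNIV (\<lambda>x. f (r C) * indicator C x)" if "C \<in> range (cyl n)" for C
      using that by (auto intro!: continuous_intros continuous_on_indicator_clopen)
    have g: "continuous_on UNIV g" unfolding g_def by (intro continuous_on_sum summand)
    have val: "state E0 \<Longrightarrow> E0 g = (\<Sum>C\<in>range (cyl n). f (r C) * E0 (indicator C))" for E0
      unfolding g_def
      by (subst state_sum, assumption, erule summand, intro sum.cong refl, subst state_scale)
        (auto intro: continuous_on_indicator_clopen)
    have "E g = E' g"
      unfolding val[OF E(1)] val[OF E(2)] by (intro sum.cong refl) (auto simp: eq)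
    have "g x = f (r (cyl n x))" for x
    proof -
      have "g x = (\<Sum>C\<in>range (cyl n). if C = cyl n x then f (r C) else 0)"
        unfolding g_def by (intro sum.cong refl) (auto simp: indicator_def dest: cyl_eq)
      then show ?thesis by (simp add: finite_cyl_range)
    qed
    moreover have "r (cyl n x) \<in> cyl n x" for x
      unfolding r_def by (rule someI[of _ x]) simp
    ultimately have "\<bar>f x - g x\<bar> \<le> e" for x
      using n[of "r (cyl n x)" x] by (smt (verit))
    then have "\<bar>E0 (\<lambda>x. f x - g x)\<bar> \<le> e" if "state E0" for E0
      using f g by (intro state_abs_le[OF that] continuous_intros) auto
    then have "\<bar>E f - E g\<bar> \<le> e" "\<bar>E' f - E' g\<bar> \<le> e"
      using E by (simp_all add: state_diff f g)
    then show ?thesis using \<open>E g = E' g\<close> by linarith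
  qed
  from this[of "\<bar>E f - E' f\<bar> / 3"] show ?thesis by (cases "E f = E' f") auto
qed

text \<open>
  Cantor's intersection theorem. Besides the Riesz representation it serves to exchange a minimum
  with the increasing limit that defines the deviation function.
\<close>

lemma nested_closed_nonempty:
  fixes A :: "nat \<Rightarrow> (nat \<Rightarrow> 'a::{finite,discrete_topology}) set"
  assumes "decseq A" "\<And>n. closed (A n)" "\<And>n. A n \<noteq> {}"
  shows "(\<Inter>n. A n) \<noteq> {}"
proof
  assume "(\<Inter>n. A n) = {}"
  then have cover: "UNIV \<subseteq> (\<Union>n\<in>UNIV. - A n)" by auto
  obtain I where I: "finite I" "UNIV \<subseteq> (\<Union>n\<in>I. - A n)"
  proof (rule compactE_image[OF compact_UNIV_shift_space, of UNIV "\<lambda>n. - A n"])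
    show "open (- A n)" for n using assms(2) by (rule open_Compl)
  qed (rule cover)
  have "x \<notin> A (Max (insert 0 I))" for x
  proof -
    obtain n where "n \<in> I" "x \<notin> A n" using I by blast
    moreover have "A (Max (insert 0 I)) \<subseteq> A n"
      using I \<open>n \<in> I\<close> by (intro decseqD[OF assms(1)] Max_ge) auto
    ultimately show ?thesis by blast
  qed
  then show False using assms(3) by blast
qed

text \<open>
  The Riesz representation is elementary here. The clopen sets form an algebra generating the Borel
  sets, and by compactness a decreasing sequence of clopen sets with empty intersection is
  eventually empty, so that finite additivity already implies countable additivity.
\<close>

lemma state_riesz:
  fixes E :: "((nat \<Rightarrow> 'a::{finite,discrete_topology}) \<Rightarrow> real) \<Rightarrow> real"
  assumes E: "state E"
  obtains \<nu> where "prob_space \<nu>" "sets \<nu> = sets borel" "\<And>f. continuous_on UNIV f \<Longrightarrow> E f = (\<integral>x. f x \<partial>\<nu>)"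
proof -
  define M where "M = {C :: (nat \<Rightarrow> 'a) set. open C \<and> closed C}"
  define p where "p C = ennreal (E (indicator C))" for C
  have cont: "continuous_on UNIV (indicator C :: _ \<Rightarrow> real)" if "C \<in> M" for C
    using that by (intro continuous_on_indicator_clopen) (auto simp: M_def)
  have nonneg: "0 \<le> E (indicator C)" if "C \<in> M" for C
    using cont[OF that] by (intro state_nonneg[OF E]) auto
  have p0: "p {} = 0"
    using state_const[OF E, of 0] by (simp add: p_def indicator_def[abs_def])
  interpret algebra UNIV M
    unfolding algebra_iff_Un by (auto simp: M_def open_Compl closed_Compl Compl_eq_Diff_UNIV[symmetric])
  have "\<exists>m. (\<forall>C\<in>M. m C = p C) \<and> measure_space UNIV (sigma_sets UNIV M) m"
  proof (rule caratheodory_empty_continuous)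
    show "positive M p" by (simp add: positive_def p0)
    show "additive M p"
      unfolding additive_def
    proof (intro ballI impI)
      fix C D assume CD: "C \<in> M" "D \<in> M" "C \<inter> D = {}"
      then have "(indicator (C \<union> D) :: _ \<Rightarrow> real) = (\<lambda>x. indicator C x + indicator D x)"
        by (auto simp: indicator_def fun_eq_iff)
      then have "E (indicator (C \<union> D)) = E (indicator C) + E (indicator D)"
        using state_add[OF E cont[OF CD(1)] cont[OF CD(2)]] by simp
      then show "p (C \<union> D) = p C + p D"
        using CD nonneg by (simp add: p_def)
    qed
    show "p C \<noteq> \<infinity>" if "C \<in> M" for C by (simp add: p_def)
    fix C :: "nat \<Rightarrow> (nat \<Rightarrow> 'a) set"
    assume C: "range C \<subseteq> M" "decseq C" "(\<Inter>i. C i) = {}"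
    then obtain n where "C n = {}"
      using nested_closed_nonempty[of C] by (auto simp: M_def)
    then have "C i = {}" if "i \<ge> n" for i
      using decseqD[OF C(2) that] by auto
    then have "eventually (\<lambda>i. p (C i) = 0) sequentially"
      unfolding eventually_sequentially using p0 by (intro exI[of _ n]) auto
    then show "(\<lambda>i. p (C i)) \<longlonglongrightarrow> 0" by (rule tendsto_eventually)
  qed
  then obtain m where m: "\<And>C. C \<in> M \<Longrightarrow> m C = p C" "measure_space UNIV (sigma_sets UNIV M) m"
    by blast
  define \<nu> where "\<nu> = measure_of UNIV M m"
  have sets: "sets \<nu> = sets borel"
    by (simp add: \<nu>_def sets_borel_clopen M_def)
  have em: "emeasure \<nu> C = p C" if "C \<in> M" for C
  proof -
    have "emeasure \<nu> C = m C"
      using that m(2) by (intro emeasure_measure_of[OF \<nu>_def])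
        (auto simp: measure_space_def M_def \<nu>_def sets_measure_of)
    then show ?thesis using m(1)[OF that] by simp
  qed
  have "p UNIV = 1"
    using state_one[OF E] by (simp add: p_def indicator_def[abs_def])
  then have prob: "prob_space \<nu>"
    using em[of UNIV] top sets_eq_imp_space_eq[OF sets] by (intro prob_spaceI) simp
  have "E f = (\<integral>x. f x \<partial>\<nu>)" if "continuous_on UNIV f" for f
  proof (rule state_eqI[OF E state_integral[OF prob sets] that])
    fix C :: "(nat \<Rightarrow> 'a) set" assume C: "open C" "closed C"
    then have CM: "C \<in> M" by (simp add: M_def)
    have "(\<integral>x. indicator C x \<partial>\<nu>) = measure \<nu> C"
      using C sets sets_eq_imp_space_eq[OF sets] by simp
    also have "\<dots> = E (indicator C)"
      using em[OF CM] nonneg[OF CM] by (simp add: measure_def p_def)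
    finally show "E (indicator C) = (\<integral>x. indicator C x \<partial>\<nu>)" by simp
  qed
  then show thesis using that prob sets by blast
qed

lemma prob_eqI_continuous:
  fixes \<nu> \<nu>' :: "(nat \<Rightarrow> 'a::{finite,discrete_topology}) measure"
  assumes "prob_space \<nu>" "sets \<nu> = sets borel" "prob_space \<nu>'" "sets \<nu>' = sets borel"
    and eq: "\<And>f :: (nat \<Rightarrow> 'a) \<Rightarrow> real. continuous_on UNIV f \<Longrightarrow> (\<integral>x. f x \<partial>\<nu>) = (\<integral>x. f x \<partial>\<nu>')"
  shows "\<nu> = \<nu>'"
proof (rule measure_eqI_generator_eq[where A = "\<lambda>_. UNIV"])
  interpret a: prob_space \<nu> by fact
  interpret b: prob_space \<nu>' by fact
  show "Int_stable {C::(nat \<Rightarrow> 'a) set. open C \<and> closed C}"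
    by (auto simp: Int_stable_def)
  show "emeasure \<nu> C = emeasure \<nu>' C" if "C \<in> {C. open C \<and> closed C}" for C
  proof -
    have "(\<integral>x. indicator C x \<partial>\<nu>) = (\<integral>x. indicator C x \<partial>\<nu>' :: real)"
      using that by (intro eq[of "indicator C"] continuous_on_indicator_clopen) auto
    then show ?thesis
      using that assms(2,4) sets_eq_imp_space_eq[OF assms(2)] sets_eq_imp_space_eq[OF assms(4)]
      by (simp add: a.emeasure_eq_measure b.emeasure_eq_measure)
  qed
qed (use assms in \<open>auto simp: sets_borel_clopen prob_space.emeasure_space_1 
    finite_measure.emeasure_finite[OF prob_space.finite_measure]\<close>)

text \<open>
  Weak compactness of the set of probabilities: it is a closed subset of a product of compact
  intervals, one for each continuous function.
\<close>

lemma state_cluster: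
  fixes E :: "'i \<Rightarrow> ((nat \<Rightarrow> 'a::{finite,discrete_topology}) \<Rightarrow> real) \<Rightarrow> real"
  assumes F: "F \<noteq> bot" and E: "eventually (\<lambda>i. state (E i)) F"
  obtains F' E' where "F' \<noteq> bot" "F' \<le> F" "state E'"
    "\<And>f. continuous_on UNIV f \<Longrightarrow> ((\<lambda>i. E i f) \<longlongrightarrow> E' f) F'"
proof -
  define G where "G i = (\<lambda>f. if continuous_on UNIV f then E i f else 0)" for i
  have "\<exists>K. continuous_on UNIV f \<longrightarrow> (\<forall>x. \<bar>f x\<bar> \<le> K)" for f :: "(nat \<Rightarrow> 'a) \<Rightarrow> real"
    using continuous_abs_bound[of f] by metis
  then have "\<exists>K. \<forall>f :: (nat \<Rightarrow> 'a) \<Rightarrow> real. continuous_on UNIV f \<longrightarrow> (\<forall>x. \<bar>f x\<bar> \<le> K f)"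
    by (intro choice allI)
  then obtain K where K: "\<And>(f :: (nat \<Rightarrow> 'a) \<Rightarrow> real) x. continuous_on UNIV f \<Longrightarrow> \<bar>f x\<bar> \<le> K f"
    by blast
  define S where "S = Pi\<^sub>E UNIV (\<lambda>f. {- \<bar>K f\<bar>..\<bar>K f\<bar>})"
  have "compactin (product_topology (\<lambda>_. euclidean) UNIV) S"
    unfolding S_def by (subst compactin_PiE) auto
  then have S: "compact S" by (simp add: euclidean_product_topology)
  have "eventually (\<lambda>i. G i \<in> S) F"
    using E
  proof eventually_elim
    case (elim i)
    have "G i f \<in> {- \<bar>K f\<bar>..\<bar>K f\<bar>}" for f
    proof (cases "continuous_on UNIV f")
      case True
      then have "\<bar>E i f\<bar> \<le> K f" using state_abs_le[OF elim True K[OF True]] by blast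
      then show ?thesis using True by (auto simp: G_def)
    qed (simp add: G_def)
    then show ?case by (auto simp: S_def)
  qed
  then have "eventually (\<lambda>g. g \<in> S) (filtermap G F)" by (simp add: eventually_filtermap)
  then obtain E' where E': "inf (nhds E') (filtermap G F) \<noteq> bot"
    using S F unfolding compact_filter by (metis filtermap_bot_iff)
  define F' where "F' = inf (filtercomap G (nhds E')) F"
  have F': "F' \<noteq> bot"
  proof
    assume "F' = bot"
    then have "eventually (\<lambda>_. False) F'" by simp
    then obtain P Q where PQ: "eventually P (filtercomap G (nhds E'))" "eventually Q F"
      "\<And>i. P i \<Longrightarrow> Q i \<Longrightarrow> False"
      unfolding F'_def eventually_inf by blast
    then obtain P' where P': "eventually P' (nhds E')" "\<And>i. P' (G i) \<Longrightarrow> P i"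
      unfolding eventually_filtercomap by blast
    have "eventually (\<lambda>i. \<not> P' (G i)) F"
      by (rule eventually_mono[OF PQ(2)]) (use P'(2) PQ(3) in blast)
    then have "eventually (\<lambda>_. False) (inf (nhds E') (filtermap G F))"
      unfolding eventually_inf eventually_filtermap using P'(1)
      by (intro exI[of _ P'] exI[of _ "\<lambda>g. \<not> P' g"]) simp
    then show False using E' trivial_limit_def by blast
  qed
  have "F' \<le> F" by (simp add: F'_def)
  have "filterlim G (nhds E') F'"
    unfolding F'_def by (rule filterlim_mono[OF filterlim_filtercomap]) auto
  then have lim0: "((\<lambda>i. G i f) \<longlongrightarrow> E' f) F'" for f
    by (rule continuous_on_tendsto_compose[OF continuous_on_product_coordinates[of f]]) auto
  have lim: "((\<lambda>i. E i f) \<longlongrightarrow> E' f) F'" if "continuous_on UNIV f" for f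
    using lim0[of f] that by (simp add: G_def)
  have st: "eventually (\<lambda>i. state (E i)) F'" using E \<open>F' \<le> F\<close> by (simp add: filter_leD)
  have "state E'"
    unfolding state_def
  proof (intro conjI allI impI)
    fix f g :: "(nat \<Rightarrow> 'a) \<Rightarrow> real" assume fg: "continuous_on UNIV f" "continuous_on UNIV g"
    have "((\<lambda>i. E i (\<lambda>x. f x + g x)) \<longlongrightarrow> E' f + E' g) F'"
      using tendsto_add[OF lim[OF fg(1)] lim[OF fg(2)]]
      by (rule Lim_transform_eventually)
        (rule eventually_mono[OF st], simp add: state_add fg)
    then show "E' (\<lambda>x. f x + g x) = E' f + E' g"
      using tendsto_unique[OF F' lim] continuous_on_add[OF fg] by blast
  next
    fix c and f :: "(nat \<Rightarrow> 'a) \<Rightarrow> real" assume f: "continuous_on UNIV f"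
    have "((\<lambda>i. E i (\<lambda>x. c * f x)) \<longlongrightarrow> c * E' f) F'"
      using tendsto_mult_left[OF lim[OF f], of c]
      by (rule Lim_transform_eventually)
        (rule eventually_mono[OF st], simp add: state_scale f)
    then show "E' (\<lambda>x. c * f x) = c * E' f"
      using tendsto_unique[OF F' lim] continuous_on_mult_left[OF f] by blast
  next
    fix f :: "(nat \<Rightarrow> 'a) \<Rightarrow> real" assume f: "continuous_on UNIV f" "\<forall>x. 0 \<le> f x"
    show "0 \<le> E' f"
      by (rule tendsto_lowerbound[OF lim[OF f(1)] _ F'])
        (rule eventually_mono[OF st], erule state_nonneg[OF _ f(1)], simp add: f(2))
  next
    have "((\<lambda>i. E i (\<lambda>_. 1)) \<longlongrightarrow> 1) F'"
      by (rule tendsto_eventually, rule eventually_mono[OF st]) (rule state_one)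
    then show "E' (\<lambda>_. 1) = 1"
      using tendsto_unique[OF F' lim[OF continuous_on_const]] by blast
  qed
  then show thesis using that F' \<open>F' \<le> F\<close> lim by blast
qed

section \<open>Convergence to the unique maximizing probability\<close>

lemma invariant_prob_state:
  "invariant_prob \<nu> \<Longrightarrow> state (\<lambda>f :: (nat \<Rightarrow> 'a::{finite,discrete_topology}) \<Rightarrow> real. \<integral>x. f x \<partial>\<nu>)"
  by (simp add: invariant_prob_def state_integral)

lemma shift_measurable [measurable]: "shift \<in> borel_measurable (borel :: (nat \<Rightarrow> 'a::topological_space) measure)"
  by (rule borel_measurable_continuous_onI[OF continuous_on_shift])

lemma invariant_prob_integral_shift:
  fixes f :: "(nat \<Rightarrow> 'a::{finite,discrete_topology}) \<Rightarrow> real"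
  assumes "invariant_prob \<nu>" "continuous_on UNIV f"
  shows "(\<integral>x. f (shift x) \<partial>\<nu>) = (\<integral>x. f x \<partial>\<nu>)"
proof -
  have s: "sets \<nu> = sets borel" and d: "distr \<nu> borel shift = \<nu>"
    using assms by (auto simp: invariant_prob_def)
  have "shift \<in> measurable \<nu> borel"
    using measurable_cong_sets[OF s refl] shift_measurable by blast
  then have "(\<integral>x. f x \<partial>distr \<nu> borel shift) = (\<integral>x. f (shift x) \<partial>\<nu>)"
    by (rule integral_distr) (rule borel_measurable_continuous_onI[OF assms(2)])
  then show ?thesis using d by simp
qed

text \<open>
  Testing against continuous functions suffices for invariance, as these determine a probability.
\<close>

lemma invariant_state_riesz:
  fixes E :: "((nat \<Rightarrow> 'a::{finite,discrete_topology}) \<Rightarrow> real) \<Rightarrow> real"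
  assumes E: "state E" and inv: "\<And>f. continuous_on UNIV f \<Longrightarrow> E (\<lambda>x. f (shift x)) = E f"
  shows "\<exists>\<nu>. invariant_prob \<nu> \<and> (\<forall>f. continuous_on UNIV f \<longrightarrow> E f = (\<integral>x. f x \<partial>\<nu>))"
proof -
  obtain \<nu> where \<nu>: "prob_space \<nu>" "sets \<nu> = sets borel" "\<And>f. continuous_on UNIV f \<Longrightarrow> E f = (\<integral>x. f x \<partial>\<nu>)"
    using state_riesz[OF E] by blast
  have m: "shift \<in> measurable \<nu> borel"
    using measurable_cong_sets[OF \<nu>(2) refl] shift_measurable by blast
  have "distr \<nu> borel shift = \<nu>"
  proof (rule prob_eqI_continuous)
    show "prob_space (distr \<nu> borel shift)" using \<nu>(1) m by (rule prob_space.prob_space_distr)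
    fix f :: "(nat \<Rightarrow> 'a) \<Rightarrow> real" assume f: "continuous_on UNIV f"
    have "(\<integral>x. f x \<partial>distr \<nu> borel shift) = (\<integral>x. f (shift x) \<partial>\<nu>)"
      by (rule integral_distr[OF m]) (rule borel_measurable_continuous_onI[OF f])
    then show "(\<integral>x. f x \<partial>distr \<nu> borel shift) = (\<integral>x. f x \<partial>\<nu>)"
      using inv[OF f] f by (simp add: \<nu>(3)[symmetric] continuous_comp)
  qed (use \<nu> in auto)
  then show ?thesis using \<nu> by (intro exI[of _ \<nu>]) (simp add: invariant_prob_def)
qed

lemma integral_le_max_mean:
  fixes A :: "(nat \<Rightarrow> 'a::{finite,discrete_topology}) \<Rightarrow> real"
  assumes "continuous_on UNIV A" "invariant_prob \<nu>"
  shows "(\<integral>x. A x \<partial>\<nu>) \<le> max_mean A"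
proof -
  obtain K where K: "\<And>x. \<bar>A x\<bar> \<le> K" using continuous_abs_bound[OF assms(1)] by metis
  have "bdd_above ((\<lambda>\<nu>. \<integral>x. A x \<partial>\<nu>) ` {\<nu>. invariant_prob \<nu>})"
    by (rule bdd_aboveI2[of _ _ K])
      (use state_le_const[OF invariant_prob_state assms(1)] K in \<open>auto simp: abs_le_iff\<close>)
  then show ?thesis unfolding max_mean_def using assms(2) by (intro cSUP_upper) auto
qed

text \<open>
  A cluster point of asymptotically invariant functionals whose values at \<open>A\<close> tend to the
  maximum is given by a maximizing probability. If there is only one, compactness turns this into
  convergence. This applies both to Gibbs states at low temperature and to the empirical averages
  along an orbit.
\<close>

lemma states_tendsto_maximizing:
  fixes A h :: "(nat \<Rightarrow> 'a::{finite,discrete_topology}) \<Rightarrow> real"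
  assumes A: "continuous_on UNIV A" and h: "continuous_on UNIV h"
    and uniq: "\<And>\<mu>'. maximizing A \<mu>' \<Longrightarrow> \<mu>' = \<mu>"
    and E: "eventually (\<lambda>i. state (E i)) F"
    and inv: "\<And>f. continuous_on UNIV f \<Longrightarrow> ((\<lambda>i. E i (\<lambda>x. f (shift x)) - E i f) \<longlongrightarrow> 0) F"
    and max: "((\<lambda>i. E i A) \<longlongrightarrow> max_mean A) F"
  shows "((\<lambda>i. E i h) \<longlongrightarrow> (\<integral>x. h x \<partial>\<mu>)) F"
proof (rule ccontr)
  define L where "L = (\<integral>x. h x \<partial>\<mu>)"
  assume "\<not> ((\<lambda>i. E i h) \<longlongrightarrow> (\<integral>x. h x \<partial>\<mu>)) F"
  then obtain e where e: "e > 0" "\<not> eventually (\<lambda>i. \<bar>E i h - L\<bar> < e) F"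
    unfolding tendsto_iff dist_real_def L_def by blast
  define F1 where "F1 = inf F (principal {i. e \<le> \<bar>E i h - L\<bar>})"
  have "F1 \<noteq> bot"
    using e(2) unfolding F1_def trivial_limit_def eventually_inf_principal by (simp add: not_le)
  moreover have "F1 \<le> F" by (simp add: F1_def)
  ultimately obtain F' E' where F': "F' \<noteq> bot" "F' \<le> F1" and E': "state E'"
    and lim: "\<And>f. continuous_on UNIV f \<Longrightarrow> ((\<lambda>i. E i f) \<longlongrightarrow> E' f) F'"
    using state_cluster[of F1 E] filter_leD[OF \<open>F1 \<le> F\<close> E] by metis
  have le: "F' \<le> F" using F'(2) \<open>F1 \<le> F\<close> by simp
  have "E' (\<lambda>x. f (shift x)) = E' f" if f: "continuous_on UNIV f" for f
    using tendsto_unique[OF F'(1) tendsto_diff[OF lim[OF continuous_comp(1)[OF f]] lim[OF f]]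
        tendsto_mono[OF le inv[OF f]]] by simp
  then obtain \<nu> where \<nu>: "invariant_prob \<nu>" "\<And>f. continuous_on UNIV f \<Longrightarrow> E' f = (\<integral>x. f x \<partial>\<nu>)"
    using invariant_state_riesz[OF E'] by blast
  have "E' A = max_mean A"
    using tendsto_unique[OF F'(1) lim[OF A] tendsto_mono[OF le max]] .
  then have "maximizing A \<nu>" using \<nu> A by (simp add: maximizing_def)
  then have "E' h = L" using uniq \<nu>(2)[OF h] by (auto simp: L_def)
  have "((\<lambda>i. \<bar>E i h - L\<bar>) \<longlongrightarrow> \<bar>E' h - L\<bar>) F'"
    by (intro tendsto_intros lim h)
  moreover have "eventually (\<lambda>i. e \<le> \<bar>E i h - L\<bar>) F'"
    using filter_leD[OF F'(2)] by (simp add: F1_def eventually_inf_principal)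
  ultimately have "e \<le> \<bar>E' h - L\<bar>" using F'(1) by (rule tendsto_lowerbound)
  then show False using e(1) \<open>E' h = L\<close> by simp
qed

text \<open>
  The hypothesis on coboundaries makes the empirical averages asymptotically invariant. It holds by
  telescoping for forward orbits and for sequences of successive preimages alike.
\<close>

lemma equidistribution:
  fixes A h :: "(nat \<Rightarrow> 'a::{finite,discrete_topology}) \<Rightarrow> real"
  assumes A: "continuous_on UNIV A" and h: "continuous_on UNIV h"
    and uniq: "\<And>\<mu>'. maximizing A \<mu>' \<Longrightarrow> \<mu>' = \<mu>"
    and inv: "\<And>f :: (nat \<Rightarrow> 'a) \<Rightarrow> real. continuous_on UNIV f \<Longrightarrow> \<exists>K. \<forall>N. \<bar>\<Sum>n<N. f (shift (u n)) - f (u n)\<bar> \<le> K"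
    and max: "\<exists>K. \<forall>N. \<bar>(\<Sum>n<N. A (u n)) - real N * max_mean A\<bar> \<le> K"
  shows "(\<lambda>N. (\<Sum>n<N. h (u n)) / N) \<longlonglongrightarrow> (\<integral>x. h x \<partial>\<mu>)"
proof (rule states_tendsto_maximizing[OF A h uniq])
  have zero: "(\<lambda>N. w N / real N) \<longlonglongrightarrow> 0" if "\<exists>K. \<forall>N. \<bar>w N\<bar> \<le> K" for w :: "nat \<Rightarrow> real"
  proof -
    obtain K where K: "\<And>N. \<bar>w N\<bar> \<le> K" using \<open>\<exists>K. \<forall>N. \<bar>w N\<bar> \<le> K\<close> by blast
    have "\<bar>w N / real N\<bar> \<le> K / real N" for N
      using K[of N] by (simp add: divide_right_mono)
    then show ?thesis
      by (intro Lim_null_comparison[OF _ lim_const_over_n[of K]] always_eventually) auto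
  qed
  show "eventually (\<lambda>N. state (\<lambda>f. (\<Sum>n<N. f (u n)) / real N)) sequentially"
    using eventually_gt_at_top[of 0]
    by eventually_elim (auto simp: state_def sum.distrib add_divide_distrib sum_distrib_left[symmetric]
      intro!: sum_nonneg divide_nonneg_nonneg)
  show "(\<lambda>N. (\<Sum>n<N. f (shift (u n))) / real N - (\<Sum>n<N. f (u n)) / real N) \<longlonglongrightarrow> 0"
    if "continuous_on UNIV f" for f :: "(nat \<Rightarrow> 'a) \<Rightarrow> real"
    using zero[of "\<lambda>N. \<Sum>n<N. f (shift (u n)) - f (u n)", OF inv[OF that]] by (simp add: sum_subtractf diff_divide_distrib)
  have "(\<lambda>N. ((\<Sum>n<N. A (u n)) - real N * max_mean A) / real N + max_mean A) \<longlonglongrightarrow> 0 + max_mean A"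
    by (intro tendsto_add zero max tendsto_const)
  moreover have "eventually (\<lambda>N. ((\<Sum>n<N. A (u n)) - real N * max_mean A) / real N + max_mean A
      = (\<Sum>n<N. A (u n)) / real N) sequentially"
    using eventually_gt_at_top[of 0] by eventually_elim (simp add: field_simps)
  ultimately show "(\<lambda>N. (\<Sum>n<N. A (u n)) / real N) \<longlonglongrightarrow> max_mean A"
    using Lim_transform_eventually by fastforce
qed

section \<open>The Ruelle operator\<close>

definition birkhoff :: "((nat \<Rightarrow> 'a) \<Rightarrow> real) \<Rightarrow> nat \<Rightarrow> (nat \<Rightarrow> 'a) \<Rightarrow> real"
  where "birkhoff B k z = (\<Sum>i<k. B ((shift ^^ i) z))"

definition prepend :: "nat \<Rightarrow> (nat \<Rightarrow> 'a) \<Rightarrow> (nat \<Rightarrow> 'a) \<Rightarrow> nat \<Rightarrow> 'a"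
  where "prepend k x z = (\<lambda>j. if j < k then x j else z (j - k))"

lemma shift_pow_prepend [simp]: "(shift ^^ k) (prepend k x z) = z"
  by (auto simp: shift_pow_nth prepend_def fun_eq_iff)

lemma prepend_mem_cyl [simp]: "prepend k x z \<in> cyl k x"
  by (simp add: mem_cyl prepend_def)

lemma finite_preimage_shift [simp]: "finite {z. shift z = (x :: nat \<Rightarrow> 'a::finite)}"
  by (simp add: preimage_shift)

lemma continuous_on_birkhoff:
  fixes B :: "(nat \<Rightarrow> 'a::discrete_topology) \<Rightarrow> real"
  shows "continuous_on UNIV B \<Longrightarrow> continuous_on UNIV (birkhoff B k)"
  unfolding birkhoff_def by (intro continuous_on_sum continuous_comp(3))

lemma birkhoff_scale: "birkhoff (\<lambda>x. c * B x) k z = c * birkhoff B k z"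
  by (simp add: birkhoff_def sum_distrib_left)

lemma continuous_on_ruelle:
  fixes B :: "(nat \<Rightarrow> 'a::{finite,discrete_topology}) \<Rightarrow> real"
  assumes "continuous_on UNIV B" "continuous_on UNIV f"
  shows "continuous_on UNIV (ruelle B f)"
  unfolding ruelle_eq_sum[abs_def]
  by (intro continuous_on_sum continuous_on_mult continuous_on_exp continuous_comp(2) assms)

lemma continuous_on_ruelle_pow:
  fixes B :: "(nat \<Rightarrow> 'a::{finite,discrete_topology}) \<Rightarrow> real"
  assumes "continuous_on UNIV B" "continuous_on UNIV f"
  shows "continuous_on UNIV ((ruelle B ^^ k) f)"
  by (induction k) (simp_all add: assms continuous_on_ruelle)

lemma ruelle_mult_shift: "ruelle B (\<lambda>z. h (shift z) * f z) x = h x * ruelle B f x"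
  unfolding ruelle_def sum_distrib_left by (intro sum.cong refl) auto

lemma ruelle_nonneg: "(\<And>z. 0 \<le> g z) \<Longrightarrow> 0 \<le> ruelle B g x"
  unfolding ruelle_def by (intro sum_nonneg) auto

lemma ruelle_pow_nonneg: "(\<And>z. 0 \<le> g z) \<Longrightarrow> 0 \<le> (ruelle B ^^ k) g x"
  by (induction k arbitrary: x) (auto intro: ruelle_nonneg)

text \<open>
  The iterates of the operator sum over preimages of order \<open>k\<close>. For the Laplace principle it is enough
  to know that such a sum is at least one of its terms and at most their number times a common bound.
\<close>

lemma ruelle_pow_ge:
  fixes z :: "nat \<Rightarrow> 'a::finite"
  assumes g: "\<And>z. 0 \<le> g z"
  shows "exp (birkhoff B k z) * g z \<le> (ruelle B ^^ k) g ((shift ^^ k) z)"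
proof (induction k)
  case 0
  then show ?case by (simp add: birkhoff_def)
next
  case (Suc k)
  define w where "w = (shift ^^ k) z"
  have "exp (birkhoff B (Suc k) z) * g z = exp (B w) * (exp (birkhoff B k z) * g z)"
    by (simp add: birkhoff_def w_def exp_add mult_ac)
  also have "\<dots> \<le> exp (B w) * (ruelle B ^^ k) g w"
    using Suc by (simp add: w_def)
  also have "\<dots> \<le> (\<Sum>v | shift v = shift w. exp (B v) * (ruelle B ^^ k) g v)"
    by (rule member_le_sum) (auto simp: ruelle_pow_nonneg[OF g])
  finally show ?case by (simp add: ruelle_def[of B "(ruelle B ^^ k) g"] w_def)
qed

lemma ruelle_pow_le:
  fixes x :: "nat \<Rightarrow> 'a::finite"
  assumes "\<And>z. (shift ^^ k) z = x \<Longrightarrow> exp (birkhoff B k z) * g z \<le> M"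
  shows "(ruelle B ^^ k) g x \<le> real CARD('a) ^ k * M"
  using assms
proof (induction k arbitrary: x M)
  case 0
  then show ?case by (simp add: birkhoff_def)
next
  case (Suc k)
  have "exp (B (case_nat a x)) * (ruelle B ^^ k) g (case_nat a x) \<le> real CARD('a) ^ k * M" for a
  proof -
    have "(ruelle B ^^ k) g (case_nat a x) \<le> real CARD('a) ^ k * (M / exp (B (case_nat a x)))"
    proof (rule Suc.IH)
      fix z assume z: "(shift ^^ k) z = case_nat a x"
      then have "exp (birkhoff B k z) * g z * exp (B (case_nat a x)) \<le> M"
        using Suc.prems[of z] by (simp add: birkhoff_def exp_add mult_ac)
      then show "exp (birkhoff B k z) * g z \<le> M / exp (B (case_nat a x))"
        by (simp add: pos_le_divide_eq)
    qed
    then show ?thesis by (simp add: field_simps)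
  qed
  then have "(\<Sum>a\<in>(UNIV :: 'a set). exp (B (case_nat a x)) * (ruelle B ^^ k) g (case_nat a x))
      \<le> (\<Sum>a\<in>(UNIV :: 'a set). real CARD('a) ^ k * M)"
    by (intro sum_mono) auto
  then show ?case by (simp add: ruelle_eq_sum[of B "(ruelle B ^^ k) g"] mult_ac)
qed

text \<open>
  The quotient of two positive eigenfunctions is constant: subtracting the largest admissible
  multiple gives a nonnegative eigenfunction with a zero, and zeros propagate to all preimages,
  which are dense.
\<close>

lemma positive_eigenfunction_unique:
  fixes B :: "(nat \<Rightarrow> 'a::{finite,discrete_topology}) \<Rightarrow> real"
  assumes cont: "continuous_on UNIV \<phi>" "continuous_on UNIV \<psi>"
    and pos: "\<And>x. 0 < \<phi> x" "\<And>x. 0 < \<psi> x"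
    and eig: "\<And>x. ruelle B \<phi> x = l * \<phi> x" "\<And>x. ruelle B \<psi> x = l * \<psi> x"
  obtains t where "t > 0" "\<And>x. \<psi> x = t * \<phi> x"
proof -
  have "continuous_on UNIV (\<lambda>x. \<psi> x / \<phi> x)"
    using pos(1) by (intro continuous_on_divide cont) (auto simp: less_imp_neq[symmetric])
  then obtain x0 where x0: "\<And>y. \<psi> x0 / \<phi> x0 \<le> \<psi> y / \<phi> y"
    using continuous_attains_min by blast
  define t where "t = \<psi> x0 / \<phi> x0"
  define u where "u x = \<psi> x - t * \<phi> x" for x
  have u0: "0 \<le> u x" for x
    using x0[of x] pos(1)[of x] by (simp add: u_def t_def[symmetric] pos_le_divide_eq)
  have step: "u z = 0" if "u (shift z) = 0" for z
  proof -
    have "ruelle B u (shift z) = l * u (shift z)"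
      using eig[of "shift z"] unfolding ruelle_def u_def
      by (simp add: algebra_simps sum_subtractf sum_distrib_left[symmetric])
    then have "(\<Sum>v | shift v = shift z. exp (B v) * u v) = 0"
      using that by (simp add: ruelle_def)
    then have "exp (B z) * u z = 0"
      by (subst (asm) sum_nonneg_eq_0_iff) (auto simp: u0)
    then show ?thesis by simp
  qed
  have zero: "u z = 0" if "(shift ^^ k) z = x0" for k z
    using that
  proof (induction k arbitrary: z)
    case 0
    then show ?case using pos(1)[of x0] by (simp add: u_def t_def)
  next
    case (Suc k)
    then have "(shift ^^ k) (shift z) = x0" by (simp only: funpow_Suc_right o_apply)
    then show ?case by (rule step[OF Suc.IH])
  qed
  have cu: "continuous_on UNIV u"
    unfolding u_def by (intro continuous_intros cont)
  have "u y = 0" for y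
  proof (rule ccontr)
    assume "u y \<noteq> 0"
    then have pos: "0 < \<bar>u y\<bar>" by simp
    obtain n where "\<And>x y'. y' \<in> cyl n x \<Longrightarrow> \<bar>u y' - u x\<bar> < \<bar>u y\<bar>"
      using continuous_cylE[OF cu pos] by blast
    from this[of "prepend n y x0" y] show False
      using zero[of n "prepend n y x0"] by simp
  qed
  then have "\<psi> x = t * \<phi> x" for x by (simp add: u_def eq_iff_diff_eq_0[of "\<psi> x"])
  moreover have "t > 0" using pos by (simp add: t_def)
  ultimately show thesis using that by blast
qed

section \<open>Gibbs states\<close>

locale gibbs =
  fixes B :: "(nat \<Rightarrow> 'a::{finite,discrete_topology}) \<Rightarrow> real"
    and \<nu> :: "(nat \<Rightarrow> 'a) measure" and \<phi> :: "(nat \<Rightarrow> 'a) \<Rightarrow> real"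
  assumes cont: "continuous_on UNIV B"
    and eigenprob: "eigenprobability B \<nu>"
    and eigenfun: "normalized_eigenfunction B \<nu> \<phi>"
begin

definition eigenvalue :: real
  where "eigenvalue = spectral_radius (ruelle_op B)"

text \<open>
  The integral with respect to the Gibbs state, the invariant probability with density \<open>\<phi>\<close> with
  respect to the eigenprobability.
\<close>

definition mean :: "((nat \<Rightarrow> 'a) \<Rightarrow> real) \<Rightarrow> real"
  where "mean f = (\<integral>x. f x * \<phi> x \<partial>\<nu>)"

lemma prob: "prob_space \<nu>" and sets: "sets \<nu> = sets borel"
  using eigenprob by (auto simp: eigenprobability_def)

lemma integral_ruelle: "continuous_on UNIV f \<Longrightarrow> (\<integral>x. ruelle B f x \<partial>\<nu>) = eigenvalue * (\<integral>x. f x \<partial>\<nu>)"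
  using eigenprob by (auto simp: eigenprobability_def eigenvalue_def)

lemma cont_phi: "continuous_on UNIV \<phi>" and phi_pos: "0 < \<phi> x"
  and ruelle_phi: "ruelle B \<phi> x = eigenvalue * \<phi> x" and integral_phi: "(\<integral>x. \<phi> x \<partial>\<nu>) = 1"
  using eigenfun by (auto simp: normalized_eigenfunction_def eigenvalue_def)

lemma state_\<nu>: "state (\<lambda>f. \<integral>x. f x \<partial>\<nu>)"
  by (rule state_integral[OF prob sets])

lemma eigenvalue_pos: "0 < eigenvalue"
proof -
  have "0 < ruelle B \<phi> x" for x
    unfolding ruelle_eq_sum by (intro sum_pos) (auto simp: phi_pos)
  then have "0 < eigenvalue * \<phi> undefined" by (simp only: ruelle_phi)
  then show ?thesis using phi_pos by (rule zero_less_mult_pos2)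
qed

lemma integral_ruelle_pow:
  "continuous_on UNIV f \<Longrightarrow> (\<integral>x. (ruelle B ^^ k) f x \<partial>\<nu>) = eigenvalue ^ k * (\<integral>x. f x \<partial>\<nu>)"
  by (induction k) (simp_all add: integral_ruelle continuous_on_ruelle_pow cont)

lemma state_mean: "state mean"
  unfolding state_def
proof (intro conjI allI impI)
  fix f g :: "(nat \<Rightarrow> 'a) \<Rightarrow> real" assume fg: "continuous_on UNIV f" "continuous_on UNIV g"
  have "mean (\<lambda>x. f x + g x) = (\<integral>x. f x * \<phi> x + g x * \<phi> x \<partial>\<nu>)"
    unfolding mean_def by (simp add: algebra_simps)
  also have "\<dots> = mean f + mean g"
    unfolding mean_def by (intro state_add[OF state_\<nu>] continuous_intros fg cont_phi)
  finally show "mean (\<lambda>x. f x + g x) = mean f + mean g" .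
next
  fix c and f :: "(nat \<Rightarrow> 'a) \<Rightarrow> real" assume "continuous_on UNIV f"
  then show "mean (\<lambda>x. c * f x) = c * mean f"
    unfolding mean_def by (simp add: mult.assoc)
next
  fix f :: "(nat \<Rightarrow> 'a) \<Rightarrow> real" assume "continuous_on UNIV f" "\<forall>x. 0 \<le> f x"
  then show "0 \<le> mean f"
    unfolding mean_def by (intro integral_nonneg_AE) (auto intro!: mult_nonneg_nonneg less_imp_le[OF phi_pos])
qed (simp add: mean_def integral_phi)

lemma mean_shift:
  assumes f: "continuous_on UNIV f"
  shows "mean (\<lambda>x. f (shift x)) = mean f"
proof -
  have "eigenvalue * mean (\<lambda>x. f (shift x)) = (\<integral>x. ruelle B (\<lambda>x. f (shift x) * \<phi> x) x \<partial>\<nu>)"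
    unfolding mean_def
    by (intro integral_ruelle[symmetric] continuous_on_mult continuous_comp(1) f cont_phi)
  also have "\<dots> = (\<integral>x. eigenvalue * (f x * \<phi> x) \<partial>\<nu>)"
    by (simp add: ruelle_mult_shift[of B f \<phi>] ruelle_phi mult.left_commute[of _ eigenvalue])
  also have "\<dots> = eigenvalue * mean f"
    unfolding mean_def by simp
  finally show ?thesis using eigenvalue_pos by simp
qed

lemma mean_invariant_prob:
  "\<exists>\<mu>. invariant_prob \<mu> \<and> (\<forall>f. continuous_on UNIV f \<longrightarrow> mean f = (\<integral>x. f x \<partial>\<mu>))"
  by (rule invariant_state_riesz[OF state_mean mean_shift])

text \<open>
  A single term of the eigenfunction equation.
\<close>

lemma potential_le: "B z \<le> ln eigenvalue + ln (\<phi> (shift z)) - ln (\<phi> z)"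
proof -
  have "exp (B z) * \<phi> z \<le> (\<Sum>v | shift v = shift z. exp (B v) * \<phi> v)"
    by (rule member_le_sum) (auto simp: less_imp_le[OF phi_pos])
  also have "\<dots> = eigenvalue * \<phi> (shift z)"
    using ruelle_phi[of "shift z"] by (simp add: ruelle_def)
  finally have "ln (exp (B z) * \<phi> z) \<le> ln (eigenvalue * \<phi> (shift z))"
    by (subst ln_le_cancel_iff) (auto simp: phi_pos eigenvalue_pos)
  then show ?thesis
    by (simp add: ln_mult_pos phi_pos eigenvalue_pos)
qed

lemma continuous_on_ln_phi: "continuous_on UNIV (\<lambda>x. ln (\<phi> x))"
  using phi_pos by (intro continuous_on_ln cont_phi) (auto simp: less_imp_neq[symmetric])

lemma max_mean_le_ln_eigenvalue: "max_mean B \<le> ln eigenvalue"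
  unfolding max_mean_def
proof (rule cSUP_least)
  show "{\<nu> :: (nat \<Rightarrow> 'a) measure. invariant_prob \<nu>} \<noteq> {}"
    using mean_invariant_prob by auto
  fix \<mu> :: "(nat \<Rightarrow> 'a) measure" assume "\<mu> \<in> {\<nu>. invariant_prob \<nu>}"
  then have inv: "invariant_prob \<mu>" by simp
  note clog = continuous_on_ln_phi
  from potential_le have "(\<integral>x. B x \<partial>\<mu>) \<le> (\<integral>x. ln eigenvalue + ln (\<phi> (shift x)) - ln (\<phi> x) \<partial>\<mu>)"
    by (intro state_mono[OF invariant_prob_state[OF inv] cont] continuous_on_diff continuous_on_add
        continuous_on_const clog continuous_comp(1)[OF clog])
  also have "\<dots> = (\<integral>x. ln eigenvalue + ln (\<phi> (shift x)) \<partial>\<mu>) - (\<integral>x. ln (\<phi> x) \<partial>\<mu>)"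
    by (intro state_diff[OF invariant_prob_state[OF inv]] continuous_on_add
        continuous_on_const clog continuous_comp(1)[OF clog])
  also have "\<dots> = ln eigenvalue"
    using state_add[OF invariant_prob_state[OF inv] continuous_on_const continuous_comp(1)[OF clog]]
      invariant_prob_integral_shift[OF inv clog] state_const[OF invariant_prob_state[OF inv]] by simp
  finally show "(\<integral>x. B x \<partial>\<mu>) \<le> ln eigenvalue" .
qed

text \<open>
  The entropy of a Gibbs state is bounded by the number of symbols. With
  \<open>r = ln \<phi> \<circ> shift - ln \<phi> - B + ln eigenvalue\<close> the weights \<open>exp (- r z)\<close> of the preimages of a
  point add up to \<open>1\<close>, the entropy is the mean of \<open>r\<close>, and \<open>r * exp (- r) \<le> 1\<close>.
\<close>

lemma ln_eigenvalue_le_mean: "ln eigenvalue \<le> mean B + CARD('a)"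
proof -
  define r where "r z = ln eigenvalue + ln (\<phi> (shift z)) - ln (\<phi> z) - B z" for z
  note clog = continuous_on_ln_phi
  note cont_intros = continuous_on_diff continuous_on_add continuous_on_const clog cont
    continuous_comp(1)[OF clog]
  have r: "continuous_on UNIV r"
    unfolding r_def by (intro cont_intros)
  have "mean r = mean (\<lambda>z. ln eigenvalue + ln (\<phi> (shift z)) - ln (\<phi> z)) - mean B"
    unfolding r_def by (intro state_diff[OF state_mean] cont_intros)
  also have "mean (\<lambda>z. ln eigenvalue + ln (\<phi> (shift z)) - ln (\<phi> z))
      = mean (\<lambda>z. ln eigenvalue + ln (\<phi> (shift z))) - mean (\<lambda>z. ln (\<phi> z))"
    by (intro state_diff[OF state_mean] cont_intros)
  also have "mean (\<lambda>z. ln eigenvalue + ln (\<phi> (shift z))) = ln eigenvalue + mean (\<lambda>z. ln (\<phi> z))"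
    using state_add[OF state_mean continuous_on_const continuous_comp(1)[OF clog]]
      mean_shift[OF clog] state_const[OF state_mean] by simp
  finally have 1: "mean r = ln eigenvalue - mean B" by simp
  have "ruelle B (\<lambda>z. r z * \<phi> z) x \<le> CARD('a) * (eigenvalue * \<phi> x)" for x
  proof -
    have "exp (B z) * (r z * \<phi> z) \<le> eigenvalue * \<phi> x" if "shift z = x" for z
    proof -
      have "exp (B z) * \<phi> z = eigenvalue * \<phi> x * exp (- r z)"
        using that phi_pos[of x] phi_pos[of z] eigenvalue_pos
        by (simp add: r_def exp_diff exp_add field_simps)
      then have "exp (B z) * (r z * \<phi> z) = eigenvalue * \<phi> x * (r z * exp (- r z))"
        by (simp add: mult_ac)
      also have "\<dots> \<le> eigenvalue * \<phi> x"
      proof -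
        have "r z \<le> exp (r z)"
          using exp_ge_add_one_self[of "r z"] by linarith
        then have "r z * exp (- r z) \<le> 1"
          by (simp add: exp_minus field_simps)
        then have "eigenvalue * \<phi> x * (r z * exp (- r z)) \<le> eigenvalue * \<phi> x * 1"
          using phi_pos eigenvalue_pos by (intro mult_left_mono) (auto intro: less_imp_le)
        then show ?thesis by simp
      qed
      finally show ?thesis .
    qed
    then show ?thesis
      using sum_bounded_above[of UNIV
          "\<lambda>a. exp (B (case_nat a x)) * (r (case_nat a x) * \<phi> (case_nat a x))" "eigenvalue * \<phi> x"]
      by (simp add: ruelle_eq_sum)
  qed
  then have "(\<integral>x. ruelle B (\<lambda>z. r z * \<phi> z) x \<partial>\<nu>) \<le> (\<integral>x. CARD('a) * (eigenvalue * \<phi> x) \<partial>\<nu>)"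
    by (intro state_mono[OF state_\<nu>] continuous_on_ruelle continuous_on_mult cont r cont_phi
        continuous_on_const)
  moreover have "(\<integral>x. ruelle B (\<lambda>z. r z * \<phi> z) x \<partial>\<nu>) = eigenvalue * mean r"
    unfolding mean_def by (intro integral_ruelle continuous_on_mult r cont_phi)
  ultimately have "eigenvalue * mean r \<le> eigenvalue * CARD('a)"
    by (simp add: integral_phi mult_ac)
  then have "mean r \<le> CARD('a)" using eigenvalue_pos by simp
  then show ?thesis using 1 by simp
qed

lemma mean_le_max_mean: "continuous_on UNIV f \<Longrightarrow> mean f \<le> max_mean f"
  using mean_invariant_prob integral_le_max_mean by fastforce

text \<open>
  Both estimates of an integral with respect to the eigenprobability pass through the Gibbs state.
  The value of \<open>\<phi>\<close> at the end point of the branch is compensated by its density; at zero temperature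
  this is how \<open>V \<circ> shift ^^ k\<close> enters the partial sums of the deviation function.
\<close>

lemma integral_le:
  assumes g: "continuous_on UNIV g"
    and M: "\<And>z. exp (birkhoff B k z) * g z \<le> M * \<phi> ((shift ^^ k) z)"
  shows "eigenvalue ^ k * (\<integral>x. g x \<partial>\<nu>) \<le> real CARD('a) ^ k * M"
proof -
  have "(ruelle B ^^ k) g x \<le> real CARD('a) ^ k * M * \<phi> x" for x
    using ruelle_pow_le[of k x B g "M * \<phi> x"] M by (metis mult.assoc)
  then have "(\<integral>x. (ruelle B ^^ k) g x \<partial>\<nu>) \<le> (\<integral>x. real CARD('a) ^ k * M * \<phi> x \<partial>\<nu>)"
    by (intro state_mono[OF state_\<nu>] continuous_on_ruelle_pow continuous_on_mult cont g cont_phi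
        continuous_on_const)
  then show ?thesis using g by (simp add: integral_ruelle_pow integral_phi)
qed

lemma integral_ge:
  assumes g: "continuous_on UNIV g" "\<And>z. 0 \<le> g z" and C: "open C" "closed C"
    and M: "\<And>z. z \<in> C \<Longrightarrow>
      M * \<phi> z \<le> exp (birkhoff B k (prepend k x z)) * g (prepend k x z)"
  shows "M * mean (indicator C) \<le> eigenvalue ^ k * (\<integral>x. g x \<partial>\<nu>)"
proof -
  have "M * (indicator C z * \<phi> z) \<le> (ruelle B ^^ k) g z" for z
  proof (cases "z \<in> C")
    case True
    then show ?thesis
      using M[OF True] ruelle_pow_ge[of g B k "prepend k x z"] g(2) by simp
  qed (simp add: ruelle_pow_nonneg g(2))
  then have "(\<integral>z. M * (indicator C z * \<phi> z) \<partial>\<nu>) \<le> (\<integral>z. (ruelle B ^^ k) g z \<partial>\<nu>)"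
    by (intro state_mono[OF state_\<nu>] continuous_on_ruelle_pow continuous_on_mult cont g cont_phi
        continuous_on_const continuous_on_indicator_clopen C)
  then show ?thesis using g(1) by (simp add: integral_ruelle_pow mean_def)
qed

end

section \<open>Involution kernels\<close>

text \<open>
  An integral or a minimum over the first variable inherits continuity in the second one, since the
  slices of a continuous function on a compact product vary uniformly.
\<close>

lemma continuous_of_slices:
  fixes F :: "(nat \<Rightarrow> 'a::{finite,discrete_topology}) \<times> (nat \<Rightarrow> 'a) \<Rightarrow> real"
  assumes F: "continuous_on UNIV F"
    and G: "\<And>y y' e. 0 < e \<Longrightarrow> (\<And>x. \<bar>F (x, y') - F (x, y)\<bar> \<le> e) \<Longrightarrow> \<bar>G y' - G y\<bar> \<le> e"
  shows "continuous_on UNIV G"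
  unfolding continuous_on_topological
proof (intro ballI allI impI)
  fix y and B :: "real set" assume "open B" "G y \<in> B"
  then obtain e where e: "e > 0" "ball (G y) e \<subseteq> B" by (meson open_contains_ball)
  have "continuous_on (UNIV \<times> UNIV) (\<lambda>p. F (prod.swap p))"
    by (rule continuous_on_compose2[OF F]) (auto intro!: continuous_on_swap)
  moreover have "0 < e / 2" using e by simp
  ultimately obtain X where X: "y \<in> X" "open X"
    "\<forall>y'\<in>X \<inter> UNIV. \<forall>x\<in>UNIV. dist (F (prod.swap (y', x))) (F (prod.swap (y, x))) \<le> e / 2"
    by (rule continuous_on_prod_compactE[OF _ compact_UNIV_shift_space UNIV_I])
  have "G y' \<in> B" if "y' \<in> X" for y'
  proof -
    have "\<bar>G y' - G y\<bar> \<le> e / 2"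
      using X(3) that e(1) by (intro G) (auto simp: dist_real_def)
    then show ?thesis using e by (auto simp: subset_iff dist_real_def abs_minus_commute)
  qed
  then show "\<exists>X. open X \<and> y \<in> X \<and> (\<forall>y'\<in>UNIV. y' \<in> X \<longrightarrow> G y' \<in> B)"
    using X by blast
qed

lemma continuous_on_integral_slice:
  fixes F :: "(nat \<Rightarrow> 'a::{finite,discrete_topology}) \<times> (nat \<Rightarrow> 'a) \<Rightarrow> real"
  assumes F: "continuous_on UNIV F" and \<nu>: "prob_space \<nu>" "sets \<nu> = sets borel"
  shows "continuous_on UNIV (\<lambda>y. \<integral>x. F (x, y) \<partial>\<nu>)"
proof (rule continuous_of_slices[OF F])
  fix y y' e assume "\<And>x. \<bar>F (x, y') - F (x, y)\<bar> \<le> e"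
  then have "\<bar>\<integral>x. F (x, y') - F (x, y) \<partial>\<nu>\<bar> \<le> e"
    by (intro state_abs_le[OF state_integral[OF \<nu>]] continuous_on_diff continuous_on_slice[OF F])
  then show "\<bar>(\<integral>x. F (x, y') \<partial>\<nu>) - (\<integral>x. F (x, y) \<partial>\<nu>)\<bar> \<le> e"
    by (simp add: state_diff[OF state_integral[OF \<nu>]] continuous_on_slice[OF F])
qed

lemma involution_kernel_scale:
  "involution_kernel A W \<Longrightarrow> involution_kernel (\<lambda>x. b * A x) (\<lambda>p. b * W p)"
  unfolding involution_kernel_def
  by (metis (mono_tags, lifting) continuous_on_mult_left distrib_left right_diff_distrib)

lemma dual_potential_scale:
  assumes "involution_kernel A W"
  shows "dual_potential (\<lambda>x. b * A x) (\<lambda>p. b * W p) y = b * dual_potential A W y"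
  unfolding dual_potential_eq[OF assms, of y undefined]
    dual_potential_eq[OF involution_kernel_scale[OF assms], of b y undefined]
  by (simp add: algebra_simps)

lemma continuous_on_dual_potential:
  fixes A :: "(nat \<Rightarrow> 'a::{finite,discrete_topology}) \<Rightarrow> real"
  assumes "continuous_on UNIV A" "involution_kernel A W"
  shows "continuous_on UNIV (dual_potential A W)"
proof -
  have W: "continuous_on UNIV W" using assms(2) by (simp add: involution_kernel_def)
  fix x0 :: "nat \<Rightarrow> 'a"
  have "continuous_on UNIV (\<lambda>y. W (tau y x0, shift y))"
    by (rule continuous_on_compose2[OF W])
      (auto intro!: continuous_on_Pair continuous_on_tau continuous_on_shift)
  then have "continuous_on UNIV (\<lambda>y. A (tau y x0) + W (tau y x0, shift y) - W (x0, y))"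
    by (intro continuous_on_diff continuous_on_add continuous_comp(4) assms(1) continuous_on_slice(2) W)
  then show ?thesis
    using dual_potential_eq[OF assms(2), of _ x0] by simp
qed

lemma dual_potential_case_nat:
  assumes "involution_kernel A W"
  shows "dual_potential A W (case_nat a y) + W (x, case_nat a y) = A (case_nat a x) + W (case_nat a x, y)"
  using dual_potential_eq[OF assms, of "case_nat a y" x] by (simp add: tau_def)

text \<open>
  Reading the cohomology equation of the kernel letter by letter, the operator of the dual
  potential acts on \<open>exp W\<close> in the second variable as the operator of the potential
  acts in the first one; the latter can be moved to the eigenprobability.
\<close>

lemma (in gibbs) kernel_eigenfunction:
  assumes W: "involution_kernel B W"
  shows "ruelle (dual_potential B W) (\<lambda>y. \<integral>x. exp (W (x, y)) \<partial>\<nu>) y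
    = eigenvalue * (\<integral>x. exp (W (x, y)) \<partial>\<nu>)"
proof -
  have cW: "continuous_on UNIV (\<lambda>p. exp (W p))"
    using W by (auto simp: involution_kernel_def intro: continuous_on_exp)
  have "ruelle (dual_potential B W) (\<lambda>y. \<integral>x. exp (W (x, y)) \<partial>\<nu>) y
      = (\<Sum>a\<in>UNIV. \<integral>x. exp (dual_potential B W (case_nat a y)) * exp (W (x, case_nat a y)) \<partial>\<nu>)"
    by (simp add: ruelle_eq_sum)
  also have "\<dots> = (\<integral>x. (\<Sum>a\<in>UNIV. exp (dual_potential B W (case_nat a y)) * exp (W (x, case_nat a y))) \<partial>\<nu>)"
    by (intro state_sum[OF state_\<nu>, symmetric] continuous_on_mult continuous_on_const continuous_on_slice(1)[OF cW])
  also have "\<dots> = (\<integral>x. ruelle B (\<lambda>x. exp (W (x, y))) x \<partial>\<nu>)"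
    unfolding ruelle_eq_sum exp_add[symmetric] dual_potential_case_nat[OF W] ..
  also have "\<dots> = eigenvalue * (\<integral>x. exp (W (x, y)) \<partial>\<nu>)"
    by (intro integral_ruelle continuous_on_slice(1)[OF cW])
  finally show ?thesis .
qed

lemma integral_pos_of_pos:
  fixes g :: "(nat \<Rightarrow> 'a::{finite,discrete_topology}) \<Rightarrow> real"
  assumes "prob_space \<nu>" "sets \<nu> = sets borel" "continuous_on UNIV g" "\<And>x. 0 < g x"
  shows "0 < (\<integral>x. g x \<partial>\<nu>)"
proof -
  obtain x0 where x0: "\<And>x. g x0 \<le> g x"
    using continuous_attains_min[OF assms(3)] by blast
  have "(\<integral>x. g x0 \<partial>\<nu>) \<le> (\<integral>x. g x \<partial>\<nu>)"
    by (rule state_mono[OF state_integral[OF assms(1,2)] continuous_on_const assms(3) x0])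
  then show ?thesis
    using assms(4)[of x0] state_const[OF state_integral[OF assms(1,2)], of "g x0"] by linarith
qed

text \<open>
  Integrating \<open>kernel_eigenfunction\<close> against the dual eigenprobability identifies the two eigenvalues;
  then uniqueness of positive eigenfunctions identifies the kernel integral up to its normalization.
\<close>

lemma gibbs_dual:
  fixes B :: "(nat \<Rightarrow> 'a::{finite,discrete_topology}) \<Rightarrow> real"
  assumes B: "gibbs B \<nu> \<phi>" and B': "gibbs (dual_potential B W) \<nu>' \<phi>'"
    and W: "involution_kernel B W"
  shows eigenvalue_dual: "gibbs.eigenvalue (dual_potential B W) = gibbs.eigenvalue B"
    and eigenfunction_dual:
      "\<phi>' y = (\<integral>x. exp (W (x, y)) \<partial>\<nu>) / (\<integral>y. (\<integral>x. exp (W (x, y)) \<partial>\<nu>) \<partial>\<nu>')"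
    and kernel_integral_pos: "0 < (\<integral>x. exp (W (x, y)) \<partial>\<nu>)"
    and kernel_double_integral_pos: "0 < (\<integral>y. (\<integral>x. exp (W (x, y)) \<partial>\<nu>) \<partial>\<nu>')"
proof -
  interpret B: gibbs B \<nu> \<phi> by (rule B)
  interpret B': gibbs "dual_potential B W" \<nu>' \<phi>' by (rule B')
  define \<psi> where "\<psi> y = (\<integral>x. exp (W (x, y)) \<partial>\<nu>)" for y
  have cW: "continuous_on UNIV (\<lambda>p. exp (W p))"
    using W by (auto simp: involution_kernel_def intro: continuous_on_exp)
  have c: "continuous_on UNIV \<psi>"
    unfolding \<psi>_def by (rule continuous_on_integral_slice[OF cW B.prob B.sets])
  have pos: "0 < \<psi> y" for y
    unfolding \<psi>_def
    by (rule integral_pos_of_pos[OF B.prob B.sets continuous_on_slice(1)[OF cW]]) simp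
  have pos2: "0 < (\<integral>y. \<psi> y \<partial>\<nu>')"
    by (rule integral_pos_of_pos[OF B'.prob B'.sets c pos])
  have eig: "ruelle (dual_potential B W) \<psi> y = B.eigenvalue * \<psi> y" for y
    unfolding \<psi>_def by (rule B.kernel_eigenfunction[OF W])
  have "B'.eigenvalue * (\<integral>y. \<psi> y \<partial>\<nu>') = B.eigenvalue * (\<integral>y. \<psi> y \<partial>\<nu>')"
    using B'.integral_ruelle[OF c] by (auto simp: eig)
  then show ev: "B'.eigenvalue = B.eigenvalue"
    using pos2 mult_right_cancel[OF less_imp_neq[OF pos2, symmetric]] by (simp only:)
  obtain t where t: "t > 0" "\<And>y. \<psi> y = t * \<phi>' y"
    using positive_eigenfunction_unique[OF B'.cont_phi c B'.phi_pos pos B'.ruelle_phi eig[folded ev]]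
    by blast
  then have "(\<integral>y. \<psi> y \<partial>\<nu>') = t" by (simp add: B'.integral_phi)
  then have "\<phi>' y = \<psi> y / (\<integral>y. \<psi> y \<partial>\<nu>')" using t by simp
  then show "\<phi>' y = (\<integral>x. exp (W (x, y)) \<partial>\<nu>) / (\<integral>y. (\<integral>x. exp (W (x, y)) \<partial>\<nu>) \<partial>\<nu>')"
    unfolding \<psi>_def .
  show "0 < (\<integral>x. exp (W (x, y)) \<partial>\<nu>)" using pos[of y] unfolding \<psi>_def .
  show "0 < (\<integral>y. (\<integral>x. exp (W (x, y)) \<partial>\<nu>) \<partial>\<nu>')" using pos2 unfolding \<psi>_def .
qed

section \<open>Hoelder potentials\<close>

lemma shift_dist_le_power:
  assumes "0 < lam" "lam < 1" "v \<in> cyl n u"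
  shows "shift_dist lam u v \<le> lam ^ n"
proof (cases "u = v")
  case False
  then obtain j where "u j \<noteq> v j" by blast
  then have "u (LEAST j. u j \<noteq> v j) \<noteq> v (LEAST j. u j \<noteq> v j)" by (rule LeastI)
  then have "n \<le> (LEAST j. u j \<noteq> v j)"
    using assms(3) by (metis mem_cyl not_le)
  then show ?thesis using False assms by (simp add: shift_dist_def power_decreasing)
qed (use assms in \<open>simp add: shift_dist_def\<close>)

lemma hoelder_cyl:
  fixes f :: "(nat \<Rightarrow> 'a) \<Rightarrow> real"
  assumes lam: "0 < lam" "lam < 1" and f: "hoelder (shift_dist lam) f"
  obtains K q where "0 \<le> K" "0 < q" "q < 1" "\<And>n u v. v \<in> cyl n u \<Longrightarrow> \<bar>f v - f u\<bar> \<le> K * q ^ n"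
proof -
  obtain C \<alpha> where C: "0 < \<alpha>" "\<And>x y. \<bar>f x - f y\<bar> \<le> C * shift_dist lam x y powr \<alpha>"
    using f by (auto simp: hoelder_def)
  define q where "q = lam powr \<alpha>"
  have "\<bar>f v - f u\<bar> \<le> \<bar>C\<bar> * q ^ n" if "v \<in> cyl n u" for n u v
  proof -
    have nn: "0 \<le> shift_dist lam u v" using lam by (simp add: shift_dist_def)
    have "\<bar>f v - f u\<bar> \<le> C * shift_dist lam u v powr \<alpha>"
      using C(2)[of u v] by (simp add: abs_minus_commute)
    also have "\<dots> \<le> \<bar>C\<bar> * shift_dist lam u v powr \<alpha>"
      by (intro mult_right_mono) auto
    also have "\<dots> \<le> \<bar>C\<bar> * (lam ^ n) powr \<alpha>"
      using shift_dist_le_power[OF lam that] nn C(1) by (intro mult_left_mono powr_mono2) auto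
    also have "(lam ^ n) powr \<alpha> = q ^ n"
      using lam by (simp add: q_def powr_powr powr_realpow[symmetric] mult.commute)
    finally show ?thesis .
  qed
  moreover have "0 < q" "q < 1"
    using lam C(1) powr_less_mono2[of \<alpha> lam 1] by (auto simp: q_def)
  ultimately show thesis using that[of "\<bar>C\<bar>" q] by simp
qed

lemma hoelder_continuous:
  fixes f :: "(nat \<Rightarrow> 'a::{finite,discrete_topology}) \<Rightarrow> real"
  assumes "0 < lam" "lam < 1" "hoelder (shift_dist lam) f"
  shows "continuous_on UNIV f"
  unfolding continuous_iff_cyl
proof (intro allI impI)
  fix e :: real assume "e > 0"
  obtain K q where K: "0 \<le> K" "0 < q" "q < 1" "\<And>n u v. v \<in> cyl n u \<Longrightarrow> \<bar>f v - f u\<bar> \<le> K * q ^ n"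
    using hoelder_cyl[OF assms] by blast
  have "(\<lambda>n. K * q ^ n) \<longlonglongrightarrow> K * 0"
    using K by (intro tendsto_mult_left LIMSEQ_power_zero) auto
  then have "eventually (\<lambda>n. K * q ^ n < e) sequentially"
    using \<open>e > 0\<close> by (intro order_tendstoD(2)[where y = "K * 0"]) auto
  then obtain n where "K * q ^ n < e" by (auto simp: eventually_sequentially)
  then show "\<exists>n. \<forall>x. \<forall>y\<in>cyl n x. \<bar>f y - f x\<bar> < e"
    using K(4) by (meson le_less_trans)
qed

lemma shift_pow_mem_cyl: "v \<in> cyl (i + n) u \<Longrightarrow> (shift ^^ i) v \<in> cyl n ((shift ^^ i) u)"
  by (simp add: mem_cyl shift_pow_nth)

text \<open>
  Bounded distortion: the oscillations of a Hoelder function along two orbits that stay together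
  for a while form a geometric series.
\<close>

lemma hoelder_distortion:
  fixes f :: "(nat \<Rightarrow> 'a) \<Rightarrow> real"
  assumes "0 < lam" "lam < 1" "hoelder (shift_dist lam) f" "e > 0"
  shows "\<exists>n. \<forall>k u v. v \<in> cyl (k + n) u \<longrightarrow> \<bar>birkhoff f k v - birkhoff f k u\<bar> \<le> e"
proof -
  obtain K q where K: "0 \<le> K" "0 < q" "q < 1" "\<And>n u v. v \<in> cyl n u \<Longrightarrow> \<bar>f v - f u\<bar> \<le> K * q ^ n"
    using hoelder_cyl[OF assms(1-3)] by blast
  have "(\<lambda>n. K / (1 - q) * q ^ n) \<longlonglongrightarrow> K / (1 - q) * 0"
    using K by (intro tendsto_mult_left LIMSEQ_power_zero) auto
  then have "eventually (\<lambda>n. K / (1 - q) * q ^ n < e) sequentially"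
    using \<open>e > 0\<close> by (intro order_tendstoD(2)[where y = "K / (1 - q) * 0"]) auto
  then obtain n where n: "K / (1 - q) * q ^ n < e" by (auto simp: eventually_sequentially)
  have "\<bar>birkhoff f k v - birkhoff f k u\<bar> \<le> e" if "v \<in> cyl (k + n) u" for k u v
  proof -
    have "\<bar>birkhoff f k v - birkhoff f k u\<bar> \<le> (\<Sum>i<k. \<bar>f ((shift ^^ i) v) - f ((shift ^^ i) u)\<bar>)"
      unfolding birkhoff_def sum_subtractf[symmetric] by (rule sum_abs)
    also have "\<dots> \<le> (\<Sum>i<k. K * q ^ n * q ^ (k - Suc i))"
    proof (rule sum_mono)
      fix i assume "i \<in> {..<k}"
      then have "i + Suc (k - Suc i + n) = k + n" by simp
      then have "(shift ^^ i) v \<in> cyl (Suc (k - Suc i + n)) ((shift ^^ i) u)"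
        using that by (intro shift_pow_mem_cyl) simp
      then have "(shift ^^ i) v \<in> cyl (k - Suc i + n) ((shift ^^ i) u)"
        using cyl_antimono[of "k - Suc i + n" "Suc (k - Suc i + n)" "(shift ^^ i) u"] by auto
      from K(4)[OF this] show "\<bar>f ((shift ^^ i) v) - f ((shift ^^ i) u)\<bar> \<le> K * q ^ n * q ^ (k - Suc i)"
        by (simp add: power_add mult_ac)
    qed
    also have "\<dots> = K * q ^ n * (\<Sum>i<k. q ^ i)"
      unfolding sum_distrib_left[symmetric] by (simp add: sum.nat_diff_reindex)
    also have "\<dots> \<le> K * q ^ n * (1 / (1 - q))"
      using K by (intro mult_left_mono) (auto simp: sum_gp_strict divide_right_mono)
    also have "\<dots> \<le> e" using n by simp
    finally show ?thesis .
  qed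
  then show ?thesis by blast
qed

section \<open>The deviation function of a subaction\<close>

locale subaction =
  fixes A V :: "(nat \<Rightarrow> 'a::{finite,discrete_topology}) \<Rightarrow> real"
  assumes cont_A: "continuous_on UNIV A" and cont_V: "continuous_on UNIV V"
    and potential_le: "A z \<le> V (shift z) - V z + max_mean A"
begin

definition slack :: "(nat \<Rightarrow> 'a) \<Rightarrow> real"
  where "slack z = V (shift z) - V z - A z + max_mean A"

text \<open>
  The partial sums of the deviation function, in telescoped form.
\<close>

definition deviation_upto :: "nat \<Rightarrow> (nat \<Rightarrow> 'a) \<Rightarrow> real"
  where "deviation_upto k x = V ((shift ^^ k) x) - V x - birkhoff A k x + k * max_mean A"

lemma slack_nonneg: "0 \<le> slack z"
  using potential_le[of z] by (simp add: slack_def)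

lemma cont_slack: "continuous_on UNIV slack"
  unfolding slack_def
  by (intro continuous_on_add continuous_on_diff continuous_on_const cont_A cont_V continuous_comp(1))

lemma deviation_upto_sum: "deviation_upto k x = (\<Sum>n<k. slack ((shift ^^ n) x))"
  by (induction k) (simp_all add: deviation_upto_def slack_def birkhoff_def algebra_simps)

lemma deviation_upto_Suc: "deviation_upto (Suc k) x = slack x + deviation_upto k (shift x)"
  unfolding deviation_upto_sum by (subst sum.lessThan_Suc_shift) (simp add: funpow_swap1)

lemma deviation_upto_mono: "k \<le> l \<Longrightarrow> deviation_upto k x \<le> deviation_upto l x"
  unfolding deviation_upto_sum by (intro sum_mono2) (auto simp: slack_nonneg)

lemma deviation_upto_nonneg: "0 \<le> deviation_upto k x"
  unfolding deviation_upto_sum by (intro sum_nonneg slack_nonneg)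

lemma cont_deviation_upto: "continuous_on UNIV (deviation_upto k)"
  unfolding deviation_upto_def
  by (intro continuous_on_add continuous_on_diff continuous_on_const cont_V continuous_comp(3)
      continuous_on_birkhoff cont_A)

lemma deviation_altdef: "deviation A V x = (\<Sum>n. ereal (slack ((shift ^^ n) x)))"
  by (simp add: deviation_def slack_def Let_def)

lemma deviation_nonneg: "0 \<le> deviation A V x"
  unfolding deviation_altdef by (intro suminf_0_le) (simp add: slack_nonneg)

lemma deviation_le_iff: "deviation A V x \<le> ereal L \<longleftrightarrow> (\<forall>k. deviation_upto k x \<le> L)"
proof
  assume *: "deviation A V x \<le> ereal L"
  show "\<forall>k. deviation_upto k x \<le> L"
  proof
    fix k
    have "ereal (deviation_upto k x) = (\<Sum>n<k. ereal (slack ((shift ^^ n) x)))"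
      by (simp add: deviation_upto_sum)
    also have "\<dots> \<le> deviation A V x"
      unfolding deviation_altdef by (rule suminf_upper) (simp add: slack_nonneg)
    also note *
    finally show "deviation_upto k x \<le> L" by simp
  qed
next
  assume "\<forall>k. deviation_upto k x \<le> L"
  then have "(\<Sum>n<k. ereal (slack ((shift ^^ n) x))) \<le> ereal L" for k
    by (simp add: deviation_upto_sum)
  then show "deviation A V x \<le> ereal L"
    unfolding deviation_altdef by (intro suminf_bound) (simp_all add: slack_nonneg)
qed

text \<open>
  The deviation functions of a point and of its image differ by the slack.
\<close>

lemma deviation_le_preimage:
  assumes "deviation A V (shift x) \<le> ereal L"
  shows "deviation A V x \<le> ereal (slack x + L)"
  unfolding deviation_le_iff
proof
  fix k show "deviation_upto k x \<le> slack x + L"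
    using assms deviation_upto_mono[of k "Suc k" x]
    by (auto simp: deviation_le_iff deviation_upto_Suc intro: order_trans)
qed

text \<open>
  The sublevel sets of \<open>g + deviation_upto k\<close> form a decreasing sequence of compact sets, so the
  minima of these functions converge to the minimum of the limit.
\<close>

lemma ex_deviation_le:
  assumes g: "continuous_on UNIV g" and ex: "\<And>k. \<exists>z. g z + deviation_upto k z \<le> L"
  shows "\<exists>z. deviation A V z \<le> ereal (L - g z)"
proof -
  define S where "S k = {z. g z + deviation_upto k z \<le> L}" for k
  have "(\<Inter>k. S k) \<noteq> {}"
  proof (rule nested_closed_nonempty)
    show "decseq S"
    proof (rule decseq_SucI)
      fix k show "S (Suc k) \<subseteq> S k"
      proof
        fix z assume "z \<in> S (Suc k)"
        then show "z \<in> S k" using deviation_upto_mono[of k "Suc k" z] by (simp add: S_def)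
      qed
    qed
    show "closed (S k)" for k
      unfolding S_def
      by (intro closed_Collect_le continuous_on_add g cont_deviation_upto continuous_on_const)
    show "S k \<noteq> {}" for k
      using ex[of k] by (auto simp: S_def)
  qed
  then obtain z where z: "\<And>k. z \<in> S k" by blast
  have "deviation A V z \<le> ereal (L - g z)"
    unfolding deviation_le_iff
  proof
    fix k show "deviation_upto k z \<le> L - g z" using z[of k] by (simp add: S_def)
  qed
  then show ?thesis by blast
qed

lemma deviation_min_attained:
  assumes g: "continuous_on UNIV g" and fin: "deviation A V x0 \<le> ereal r0"
  shows "\<exists>L. is_min_of (ereal L) (range (\<lambda>x. ereal (g x) + deviation A V x))"
proof -
  define h where "h x = ereal (g x) + deviation A V x" for x
  obtain p where p: "\<And>x. g p \<le> g x" using continuous_attains_min[OF g] by blast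
  have upto_le: "ereal (deviation_upto k x) \<le> deviation A V x" for k x
  proof (cases "deviation A V x")
    case (real r)
    then show ?thesis using deviation_le_iff[of x r] by simp
  next
    case MInf
    then show ?thesis using deviation_nonneg[of x] by simp
  qed simp
  have upto: "ereal (g x + deviation_upto k x) \<le> h x" for k x
    using add_left_mono[OF upto_le[of k x], of "ereal (g x)"] by (simp add: h_def)
  have lb: "ereal (g p) \<le> h x" for x
  proof -
    have "ereal (g p) \<le> ereal (g x + deviation_upto 0 x)"
      using p[of x] deviation_upto_nonneg[of 0 x] by simp
    then show ?thesis using upto[of x 0] by (rule order_trans)
  qed
  have "(INF x. h x) \<le> h x0" by (rule INF_lower) simp
  also have "\<dots> \<le> ereal (g x0 + r0)"
    using add_left_mono[OF fin, of "ereal (g x0)"] by (simp add: h_def)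
  finally have "(INF x. h x) < \<infinity>" by (rule le_less_trans) simp
  moreover have "ereal (g p) \<le> (INF x. h x)" by (rule INF_greatest) (rule lb)
  ultimately obtain L where L: "(INF x. h x) = ereal L"
    by (cases "INF x. h x") auto
  have "\<exists>z. g z + deviation_upto k z \<le> L" for k
  proof -
    obtain z where z: "\<And>x. g z + deviation_upto k z \<le> g x + deviation_upto k x"
      using continuous_attains_min[OF continuous_on_add[OF g cont_deviation_upto]] by blast
    have "ereal (g z + deviation_upto k z) \<le> (INF x. h x)"
    proof (rule INF_greatest)
      fix x
      have "ereal (g z + deviation_upto k z) \<le> ereal (g x + deviation_upto k x)" using z by simp
      also have "\<dots> \<le> h x" by (rule upto)
      finally show "ereal (g z + deviation_upto k z) \<le> h x" .
    qed
    then show ?thesis unfolding L by auto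
  qed
  then obtain z where z: "deviation A V z \<le> ereal (L - g z)"
    using ex_deviation_le[OF g] by blast
  have "h z \<le> ereal L"
    using add_left_mono[OF z, of "ereal (g z)"] by (simp add: h_def)
  moreover have le: "ereal L \<le> h x" for x
    unfolding L[symmetric] by (rule INF_lower) simp
  ultimately have "h z = ereal L" using le[of z] by (intro antisym)
  then have "is_min_of (ereal L) (range h)"
    unfolding is_min_of_def using le by (metis imageE rangeI)
  then show ?thesis unfolding h_def[abs_def] by blast
qed

end

section \<open>Zero temperature limits\<close>

text \<open>
  The pressure of \<open>b * A\<close> lies between its maximal mean and its Gibbs mean plus the entropy, which is
  bounded independently of \<open>b\<close>. Division by \<open>b\<close> makes the entropy disappear in the limit.
\<close>

lemma pressure_bounds:
  fixes A :: "(nat \<Rightarrow> 'a::{finite,discrete_topology}) \<Rightarrow> real"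
  assumes A: "continuous_on UNIV A" and \<mu>: "maximizing A \<mu>" and b: "b > 0"
    and G: "gibbs (\<lambda>x. b * A x) \<nu> \<phi>"
  shows "max_mean A \<le> ln (gibbs.eigenvalue (\<lambda>x. b * A x)) / b"
    and "ln (gibbs.eigenvalue (\<lambda>x. b * A x)) / b \<le> gibbs.mean \<nu> \<phi> A + CARD('a) / b"
    and "gibbs.mean \<nu> \<phi> A \<le> max_mean A"
proof -
  interpret gibbs "\<lambda>x. b * A x" \<nu> \<phi> by (rule G)
  have inv: "invariant_prob \<mu>" and max: "(\<integral>x. A x \<partial>\<mu>) = max_mean A"
    using \<mu> by (auto simp: maximizing_def)
  have "b * max_mean A = (\<integral>x. b * A x \<partial>\<mu>)"
    using max by simp
  also have "\<dots> \<le> max_mean (\<lambda>x. b * A x)"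
    by (rule integral_le_max_mean[OF cont inv])
  also have "\<dots> \<le> ln eigenvalue" by (rule max_mean_le_ln_eigenvalue)
  finally show "max_mean A \<le> ln eigenvalue / b" using b by (simp add: field_simps)
  show "ln eigenvalue / b \<le> mean A + CARD('a) / b"
    using ln_eigenvalue_le_mean b state_scale[OF state_mean A, of b] by (simp add: field_simps)
  show "mean A \<le> max_mean A" by (rule mean_le_max_mean[OF A])
qed

lemma tendsto_divide_at_top:
  fixes f :: "real \<Rightarrow> real"
  assumes "(f \<longlongrightarrow> l) at_top"
  shows "((\<lambda>b. f b / b) \<longlongrightarrow> 0) at_top"
  by (rule real_tendsto_divide_at_top[OF assms filterlim_ident])

lemma pressure_tendsto:
  fixes A :: "(nat \<Rightarrow> 'a::{finite,discrete_topology}) \<Rightarrow> real"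
  assumes A: "continuous_on UNIV A" and \<mu>: "maximizing A \<mu>"
    and G: "\<And>b. b > 0 \<Longrightarrow> gibbs (\<lambda>x. b * A x) (\<nu> b) (\<phi> b)"
  shows "((\<lambda>b. ln (gibbs.eigenvalue (\<lambda>x. b * A x)) / b) \<longlongrightarrow> max_mean A) at_top"
    and "((\<lambda>b. gibbs.mean (\<nu> b) (\<phi> b) A) \<longlongrightarrow> max_mean A) at_top"
proof -
  note bounds = pressure_bounds[OF A \<mu> _ G]
  have d: "((\<lambda>b. real CARD('a) / b) \<longlongrightarrow> 0) at_top"
    by (rule tendsto_divide_at_top[OF tendsto_const])
  have pos: "eventually (\<lambda>b::real. 0 < b) at_top" by (rule eventually_gt_at_top)
  show "((\<lambda>b. ln (gibbs.eigenvalue (\<lambda>x. b * A x)) / b) \<longlongrightarrow> max_mean A) at_top"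
  proof (rule tendsto_sandwich[OF _ _ tendsto_const])
    show "eventually (\<lambda>b. max_mean A \<le> ln (gibbs.eigenvalue (\<lambda>x. b * A x)) / b) at_top"
      by (rule eventually_mono[OF pos]) (rule bounds(1))
    show "eventually (\<lambda>b. ln (gibbs.eigenvalue (\<lambda>x. b * A x)) / b \<le> max_mean A + real CARD('a) / b) at_top"
    proof (rule eventually_mono[OF pos])
      fix b :: real assume "0 < b"
      from bounds(2,3)[OF this this]
      show "ln (gibbs.eigenvalue (\<lambda>x. b * A x)) / b \<le> max_mean A + real CARD('a) / b" by linarith
    qed
    show "((\<lambda>b. max_mean A + real CARD('a) / b) \<longlongrightarrow> max_mean A) at_top"
      using tendsto_add[OF tendsto_const d] by simp
  qed
  show "((\<lambda>b. gibbs.mean (\<nu> b) (\<phi> b) A) \<longlongrightarrow> max_mean A) at_top"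
  proof (rule tendsto_sandwich[OF _ _ _ tendsto_const])
    show "eventually (\<lambda>b. gibbs.mean (\<nu> b) (\<phi> b) A \<le> max_mean A) at_top"
      by (rule eventually_mono[OF pos]) (rule bounds(3))
    show "eventually (\<lambda>b. max_mean A - real CARD('a) / b \<le> gibbs.mean (\<nu> b) (\<phi> b) A) at_top"
    proof (rule eventually_mono[OF pos])
      fix b :: real assume "0 < b"
      from bounds(1,2)[OF this this]
      show "max_mean A - real CARD('a) / b \<le> gibbs.mean (\<nu> b) (\<phi> b) A" by linarith
    qed
    show "((\<lambda>b. max_mean A - real CARD('a) / b) \<longlongrightarrow> max_mean A) at_top"
      using tendsto_diff[OF tendsto_const d] by simp
  qed
qed

text \<open>
  The inequality of a subaction is the limit of the single-term estimate \<open>gibbs.potential_le\<close>.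
\<close>

lemma subaction_limit:
  fixes A V :: "(nat \<Rightarrow> 'a::{finite,discrete_topology}) \<Rightarrow> real"
  assumes A: "continuous_on UNIV A" and \<mu>: "maximizing A \<mu>"
    and G: "\<And>b. b > 0 \<Longrightarrow> gibbs (\<lambda>x. b * A x) (\<nu> b) (\<phi> b)"
    and V: "uniform_limit UNIV (\<lambda>b x. 1 / b * ln (\<phi> b x)) V at_top"
  shows "subaction A V"
proof
  show "continuous_on UNIV A" by (rule A)
  have pos: "eventually (\<lambda>b::real. 0 < b) at_top" by (rule eventually_gt_at_top)
  have "eventually (\<lambda>b. continuous_on UNIV (\<lambda>x. 1 / b * ln (\<phi> b x))) at_top"
    by (rule eventually_mono[OF pos])
      (intro continuous_on_mult continuous_on_const gibbs.continuous_on_ln_phi[OF G])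
  then show "continuous_on UNIV V"
    by (rule uniform_limit_theorem[OF _ V]) simp
  fix z
  have V': "((\<lambda>b. 1 / b * ln (\<phi> b x)) \<longlongrightarrow> V x) at_top" for x
    by (rule tendsto_uniform_limitI[OF V]) simp
  show "A z \<le> V (shift z) - V z + max_mean A"
  proof (rule tendsto_le[OF _ _ tendsto_const])
    show "((\<lambda>b. 1 / b * ln (\<phi> b (shift z)) - 1 / b * ln (\<phi> b z)
        + ln (gibbs.eigenvalue (\<lambda>x. b * A x)) / b) \<longlongrightarrow> V (shift z) - V z + max_mean A) at_top"
      by (intro tendsto_add tendsto_diff V' pressure_tendsto(1)[OF A \<mu> G])
    show "eventually (\<lambda>b. A z \<le> 1 / b * ln (\<phi> b (shift z)) - 1 / b * ln (\<phi> b z)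
        + ln (gibbs.eigenvalue (\<lambda>x. b * A x)) / b) at_top"
    proof (rule eventually_mono[OF pos])
      fix b :: real assume b: "0 < b"
      show "A z \<le> 1 / b * ln (\<phi> b (shift z)) - 1 / b * ln (\<phi> b z)
        + ln (gibbs.eigenvalue (\<lambda>x. b * A x)) / b"
        using gibbs.potential_le[OF G[OF b], of z] b by (simp add: field_simps)
    qed
  qed simp
qed

text \<open>
  Both potentials with their families of Gibbs states. Hoelder regularity of \<open>A\<close> is represented by its
  consequence for Birkhoff sums, bounded distortion, which the lower bound of the Laplace principle
  relies on.
\<close>

locale zero_temperature =
  fixes A V Vs :: "(nat \<Rightarrow> 'a::{finite,discrete_topology}) \<Rightarrow> real"
    and W :: "(nat \<Rightarrow> 'a) \<times> (nat \<Rightarrow> 'a) \<Rightarrow> real"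
    and \<mu> \<mu>s :: "(nat \<Rightarrow> 'a) measure"
    and \<nu> \<nu>s :: "real \<Rightarrow> (nat \<Rightarrow> 'a) measure"
    and \<phi> \<phi>s :: "real \<Rightarrow> (nat \<Rightarrow> 'a) \<Rightarrow> real"
    and \<gamma> :: real
  assumes cont_A: "continuous_on UNIV A"
    and distortion: "\<And>e. e > 0 \<Longrightarrow>
      \<exists>n. \<forall>k u v. v \<in> cyl (k + n) u \<longrightarrow> \<bar>birkhoff A k v - birkhoff A k u\<bar> \<le> e"
    and \<mu>: "maximizing A \<mu>" "\<And>\<mu>'. maximizing A \<mu>' \<Longrightarrow> \<mu>' = \<mu>"
    and W: "involution_kernel A W"
    and \<mu>s: "maximizing (dual_potential A W) \<mu>s"
    and G: "\<And>b. b > 0 \<Longrightarrow> gibbs (\<lambda>x. b * A x) (\<nu> b) (\<phi> b)"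
    and Gs: "\<And>b. b > 0 \<Longrightarrow> gibbs (\<lambda>y. b * dual_potential A W y) (\<nu>s b) (\<phi>s b)"
    and V: "uniform_limit UNIV (\<lambda>b x. 1 / b * ln (\<phi> b x)) V at_top"
    and Vs: "uniform_limit UNIV (\<lambda>b y. 1 / b * ln (\<phi>s b y)) Vs at_top"
    and \<gamma>: "((\<lambda>b. 1 / b * ln (\<integral>y. (\<integral>x. exp (b * W (x, y)) \<partial>\<nu> b) \<partial>\<nu>s b)) \<longlongrightarrow> \<gamma>) at_top"
begin

abbreviation As :: "(nat \<Rightarrow> 'a) \<Rightarrow> real"
  where "As \<equiv> dual_potential A W"

abbreviation pressure :: "real \<Rightarrow> real"
  where "pressure b \<equiv> ln (gibbs.eigenvalue (\<lambda>x. b * A x))"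

lemma cont_W: "continuous_on UNIV W"
  using W by (simp add: involution_kernel_def)

lemma cont_As: "continuous_on UNIV As"
  by (rule continuous_on_dual_potential[OF cont_A W])

lemma cont_exp_W: "continuous_on UNIV (\<lambda>x. exp (b * W (x, y)))"
  by (intro continuous_on_exp continuous_on_mult continuous_on_const continuous_on_slice(1)[OF cont_W])

lemma dual_scale: "dual_potential (\<lambda>x. b * A x) (\<lambda>p. b * W p) = (\<lambda>y. b * As y)"
  by (rule ext) (rule dual_potential_scale[OF W])

sublocale subaction A V
  by (rule subaction_limit[OF cont_A \<mu>(1) G V])

sublocale dual: subaction As Vs
  by (rule subaction_limit[OF cont_As \<mu>s Gs Vs])

lemma dual_at:
  assumes "b > 0"
  shows "gibbs.eigenvalue (\<lambda>y. b * As y) = gibbs.eigenvalue (\<lambda>x. b * A x)"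
    and "\<phi>s b y = (\<integral>x. exp (b * W (x, y)) \<partial>\<nu> b) / (\<integral>y. (\<integral>x. exp (b * W (x, y)) \<partial>\<nu> b) \<partial>\<nu>s b)"
    and "0 < (\<integral>x. exp (b * W (x, y)) \<partial>\<nu> b)"
    and "0 < (\<integral>y. (\<integral>x. exp (b * W (x, y)) \<partial>\<nu> b) \<partial>\<nu>s b)"
  using gibbs_dual[OF G[OF assms], of "\<lambda>p. b * W p" "\<nu>s b" "\<phi>s b"]
    involution_kernel_scale[OF W, of b] Gs[OF assms]
  unfolding dual_scale by blast+

lemma max_mean_dual: "max_mean As = max_mean A"
proof (rule tendsto_unique[OF _ pressure_tendsto(1)[OF cont_As \<mu>s Gs]])
  show "((\<lambda>b. ln (gibbs.eigenvalue (\<lambda>y. b * As y)) / b) \<longlongrightarrow> max_mean A) at_top"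
  proof (rule Lim_transform_eventually)
    show "((\<lambda>b. pressure b / b) \<longlongrightarrow> max_mean A) at_top"
      by (rule pressure_tendsto(1)[OF cont_A \<mu>(1) G])
    show "eventually (\<lambda>b. pressure b / b = ln (gibbs.eigenvalue (\<lambda>y. b * As y)) / b) at_top"
      using eventually_gt_at_top[of 0] by eventually_elim (simp add: dual_at(1))
  qed
qed simp

lemma kernel_integral_tendsto:
  "((\<lambda>b. ln (\<integral>x. exp (b * W (x, y)) \<partial>\<nu> b) / b) \<longlongrightarrow> Vs y + \<gamma>) at_top"
proof (rule Lim_transform_eventually)
  show "((\<lambda>b. 1 / b * ln (\<phi>s b y) + 1 / b * ln (\<integral>y. (\<integral>x. exp (b * W (x, y)) \<partial>\<nu> b) \<partial>\<nu>s b))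
      \<longlongrightarrow> Vs y + \<gamma>) at_top"
    by (intro tendsto_add tendsto_uniform_limitI[OF Vs] \<gamma>) simp
  show "eventually (\<lambda>b. 1 / b * ln (\<phi>s b y) + 1 / b * ln (\<integral>y. (\<integral>x. exp (b * W (x, y)) \<partial>\<nu> b) \<partial>\<nu>s b)
      = ln (\<integral>x. exp (b * W (x, y)) \<partial>\<nu> b) / b) at_top"
  proof (rule eventually_mono[OF eventually_gt_at_top[of 0]])
    fix b :: real assume b: "0 < b"
    have "ln (\<phi>s b y) = ln (\<integral>x. exp (b * W (x, y)) \<partial>\<nu> b)
        - ln (\<integral>y. (\<integral>x. exp (b * W (x, y)) \<partial>\<nu> b) \<partial>\<nu>s b)"
      unfolding dual_at(2)[OF b] by (rule ln_divide_pos[OF dual_at(3,4)[OF b]])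
    then show "1 / b * ln (\<phi>s b y) + 1 / b * ln (\<integral>y. (\<integral>x. exp (b * W (x, y)) \<partial>\<nu> b) \<partial>\<nu>s b)
      = ln (\<integral>x. exp (b * W (x, y)) \<partial>\<nu> b) / b"
      by (simp add: diff_divide_distrib)
  qed
qed

lemma mean_tendsto:
  assumes "continuous_on UNIV h"
  shows "((\<lambda>b. gibbs.mean (\<nu> b) (\<phi> b) h) \<longlongrightarrow> (\<integral>x. h x \<partial>\<mu>)) at_top"
proof (rule states_tendsto_maximizing[OF cont_A assms \<mu>(2)])
  have pos: "eventually (\<lambda>b::real. 0 < b) at_top" by (rule eventually_gt_at_top)
  show "eventually (\<lambda>b. state (gibbs.mean (\<nu> b) (\<phi> b))) at_top"
    by (rule eventually_mono[OF pos]) (rule gibbs.state_mean[OF G])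
  show "((\<lambda>b. gibbs.mean (\<nu> b) (\<phi> b) (\<lambda>x. f (shift x)) - gibbs.mean (\<nu> b) (\<phi> b) f) \<longlongrightarrow> 0) at_top"
    if "continuous_on UNIV f" for f
    by (rule tendsto_eventually, rule eventually_mono[OF pos]) (simp add: gibbs.mean_shift[OF G that])
  show "((\<lambda>b. gibbs.mean (\<nu> b) (\<phi> b) A) \<longlongrightarrow> max_mean A) at_top"
    by (rule pressure_tendsto(2)[OF cont_A \<mu>(1) G])
qed

lemma eventually_phi_close:
  assumes "e > 0"
  shows "eventually (\<lambda>b. 0 < b \<and> (\<forall>z. exp (b * (V z - e)) \<le> \<phi> b z \<and> \<phi> b z \<le> exp (b * (V z + e)))) at_top"
proof -
  have "eventually (\<lambda>b. \<forall>z\<in>UNIV. dist (1 / b * ln (\<phi> b z)) (V z) < e) at_top"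
    using V assms by (rule uniform_limitD)
  then show ?thesis
    using eventually_gt_at_top[of 0]
  proof eventually_elim
    case (elim b)
    have "exp (b * (V z - e)) \<le> \<phi> b z \<and> \<phi> b z \<le> exp (b * (V z + e))" for z
    proof -
      have "\<bar>1 / b * ln (\<phi> b z) - V z\<bar> < e" using elim by (auto simp: dist_real_def)
      then have "b * (V z - e) \<le> ln (\<phi> b z)" "ln (\<phi> b z) \<le> b * (V z + e)"
        using elim by (simp_all add: abs_less_iff field_simps)
      then show ?thesis
        using gibbs.phi_pos[OF G[of b], of z] elim by (metis exp_le_cancel_iff exp_ln)
    qed
    then show ?case using elim by blast
  qed
qed

section \<open>Laplace principle for the kernel integral\<close>

text \<open>
  The upper bound in the Laplace principle: among the preimages of order \<open>k\<close> the largest term decides,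
  since their number contributes only \<open>k * ln CARD('a) / b\<close> to the exponent.
\<close>

lemma kernel_le:
  "\<exists>z. V z + deviation_upto k z - W (z, y) \<le> - (Vs y + \<gamma>)"
proof -
  \<comment> \<open>up to the constant \<open>k * max_mean A\<close> this is \<open>V + deviation_upto k - W\<close>\<close>
  define H where "H z = V ((shift ^^ k) z) - birkhoff A k z - W (z, y)" for z
  have "continuous_on UNIV H"
    unfolding H_def
    by (intro continuous_on_diff continuous_comp(3) cont_V continuous_on_birkhoff cont_A
        continuous_on_slice(1)[OF cont_W])
  then obtain z0 where z0: "\<And>z. H z0 \<le> H z" using continuous_attains_min by blast
  have "k * max_mean A + (Vs y + \<gamma>) \<le> - H z0 + e" if e: "e > 0" for e
  proof (rule tendsto_le)
    show "((\<lambda>b. k * (pressure b / b) + ln (\<integral>x. exp (b * W (x, y)) \<partial>\<nu> b) / b)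
        \<longlongrightarrow> k * max_mean A + (Vs y + \<gamma>)) at_top"
      by (intro tendsto_add tendsto_mult_left pressure_tendsto(1)[OF cont_A \<mu>(1) G] kernel_integral_tendsto)
    have "((\<lambda>b. (k * ln CARD('a)) / b + (- H z0 + e)) \<longlongrightarrow> 0 + (- H z0 + e)) at_top"
      by (rule tendsto_add[OF tendsto_divide_at_top[OF tendsto_const] tendsto_const])
    then show "((\<lambda>b. (k * ln CARD('a)) / b + (- H z0 + e)) \<longlongrightarrow> - H z0 + e) at_top" by simp
    show "eventually (\<lambda>b. k * (pressure b / b) + ln (\<integral>x. exp (b * W (x, y)) \<partial>\<nu> b) / b
        \<le> (k * ln CARD('a)) / b + (- H z0 + e)) at_top"
      using eventually_phi_close[OF e]
    proof eventually_elim
      case (elim b)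
      then have b: "b > 0" by blast
      interpret gibbs "\<lambda>x. b * A x" "\<nu> b" "\<phi> b" by (rule G[OF b])
      define M where "M = exp (b * (- H z0 + e))"
      have "eigenvalue ^ k * (\<integral>x. exp (b * W (x, y)) \<partial>\<nu> b) \<le> real CARD('a) ^ k * M"
      proof (rule integral_le[OF cont_exp_W])
        fix z
        have "exp (birkhoff (\<lambda>x. b * A x) k z) * exp (b * W (z, y)) = exp (b * (birkhoff A k z + W (z, y)))"
          by (simp add: birkhoff_scale exp_add[symmetric] distrib_left)
        also have "\<dots> \<le> exp (b * (- H z0 + e + (V ((shift ^^ k) z) - e)))"
          using z0[of z] b by (simp add: H_def)
        also have "\<dots> = M * exp (b * (V ((shift ^^ k) z) - e))"
          by (simp add: M_def exp_add[symmetric], simp add: algebra_simps)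
        also have "\<dots> \<le> M * \<phi> b ((shift ^^ k) z)"
          using elim by (intro mult_left_mono) (auto simp: M_def)
        finally show "exp (birkhoff (\<lambda>x. b * A x) k z) * exp (b * W (z, y)) \<le> M * \<phi> b ((shift ^^ k) z)" .
      qed
      moreover have "0 < eigenvalue ^ k * (\<integral>x. exp (b * W (x, y)) \<partial>\<nu> b)"
        using eigenvalue_pos dual_at(3)[OF b] by simp
      ultimately have "ln (eigenvalue ^ k * (\<integral>x. exp (b * W (x, y)) \<partial>\<nu> b)) \<le> ln (real CARD('a) ^ k * M)"
        by simp
      then have "k * ln eigenvalue + ln (\<integral>x. exp (b * W (x, y)) \<partial>\<nu> b) \<le> k * ln CARD('a) + b * (- H z0 + e)"
        using eigenvalue_pos dual_at(3)[OF b] by (simp add: ln_mult_pos ln_realpow M_def)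
      from divide_right_mono[OF this less_imp_le[OF b]] show ?case
        using b by (simp add: add_divide_distrib)
    qed
  qed simp
  then have "k * max_mean A + (Vs y + \<gamma>) \<le> - H z0" by (rule field_le_epsilon)
  then show ?thesis by (intro exI[of _ z0]) (simp add: deviation_upto_def H_def)
qed

text \<open>
  Along an orbit of finite deviation the Birkhoff sums of \<open>A\<close> stay within a bounded distance of their
  maximal possible growth.
\<close>

lemma forward_orbit_equidistributed:
  assumes L: "\<And>k. deviation_upto k x \<le> L" and h: "continuous_on UNIV h"
  shows "(\<lambda>N. (\<Sum>n<N. h ((shift ^^ n) x)) / N) \<longlonglongrightarrow> (\<integral>x. h x \<partial>\<mu>)"
proof (rule equidistribution[OF cont_A h \<mu>(2)])
  fix f :: "(nat \<Rightarrow> 'a) \<Rightarrow> real" assume "continuous_on UNIV f"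
  then obtain K where K: "\<And>x. \<bar>f x\<bar> \<le> K" using continuous_abs_bound by blast
  have "(\<Sum>n<N. f (shift ((shift ^^ n) x)) - f ((shift ^^ n) x)) = f ((shift ^^ N) x) - f x" for N
    using sum_lessThan_telescope[of "\<lambda>n. f ((shift ^^ n) x)" N] by simp
  then have "\<bar>\<Sum>n<N. f (shift ((shift ^^ n) x)) - f ((shift ^^ n) x)\<bar> \<le> 2 * K" for N
    using K[of "(shift ^^ N) x"] K[of x] by simp
  then show "\<exists>K. \<forall>N. \<bar>\<Sum>n<N. f (shift ((shift ^^ n) x)) - f ((shift ^^ n) x)\<bar> \<le> K" by blast
next
  obtain K where K: "\<And>x. \<bar>V x\<bar> \<le> K" using continuous_abs_bound[OF cont_V] by blast
  have "\<bar>(\<Sum>n<N. A ((shift ^^ n) x)) - real N * max_mean A\<bar> \<le> 2 * K + L" for N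
    using K[of "(shift ^^ N) x"] K[of x] L[of N] deviation_upto_nonneg[of N x]
    by (simp add: deviation_upto_def birkhoff_def)
  then show "\<exists>K. \<forall>N. \<bar>(\<Sum>n<N. A ((shift ^^ n) x)) - real N * max_mean A\<bar> \<le> K" by blast
qed

lemma prob_\<mu>: "prob_space \<mu>" "sets \<mu> = sets borel" "invariant_prob \<mu>"
  using \<mu>(1) by (auto simp: maximizing_def invariant_prob_def)

lemma ex_charged_cyl: "\<exists>x. 0 < measure \<mu> (cyl n x)"
proof (rule ccontr)
  interpret prob_space \<mu> by (rule prob_\<mu>(1))
  have cyl: "cyl n x \<in> sets \<mu>" for x using prob_\<mu>(2) by simp
  assume "\<not> ?thesis"
  then have "prob (cyl n x) = 0" for x
    using measure_nonneg[of \<mu> "cyl n x"] by (metis less_eq_real_def)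
  then have "C \<in> null_sets \<mu>" if "C \<in> range (cyl n)" for C
    using that cyl by (auto simp: emeasure_eq_measure)
  then have "\<Union>(range (cyl n)) \<in> null_sets \<mu>"
    using finite_cyl_range by (intro null_sets_UN'[of _ "\<lambda>C. C", simplified]) (auto intro: countable_finite)
  moreover have "\<Union>(range (cyl n)) = space \<mu>"
    using self_mem_cyl sets_eq_imp_space_eq[OF prob_\<mu>(2)] by auto
  ultimately show False using emeasure_space_1 by auto
qed

text \<open>
  Some cylinder of length \<open>n\<close> has positive measure, and an equidistributed orbit enters it.
\<close>

lemma visits_charged_cyl:
  assumes L: "\<And>k. deviation_upto k x \<le> L"
  obtains k where "0 < measure \<mu> (cyl n ((shift ^^ k) x))"
proof -
  obtain p where p: "0 < measure \<mu> (cyl n p)" using ex_charged_cyl by blast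
  have "(\<lambda>N. (\<Sum>i<N. indicator (cyl n p) ((shift ^^ i) x)) / real N) \<longlonglongrightarrow> (\<integral>x. indicator (cyl n p) x \<partial>\<mu>)"
    by (rule forward_orbit_equidistributed[OF L continuous_on_indicator_clopen[OF open_cyl closed_cyl]])
  also have "(\<integral>x. indicator (cyl n p) x \<partial>\<mu>) = measure \<mu> (cyl n p)"
    using prob_\<mu>(2) sets_eq_imp_space_eq[OF prob_\<mu>(2)] by simp
  finally have lim: "(\<lambda>N. (\<Sum>i<N. indicator (cyl n p) ((shift ^^ i) x)) / real N) \<longlonglongrightarrow> measure \<mu> (cyl n p)" .
  have "\<exists>k. (shift ^^ k) x \<in> cyl n p"
  proof (rule ccontr)
    assume "\<not> ?thesis"
    then have "(\<lambda>N. (\<Sum>i<N. indicator (cyl n p) ((shift ^^ i) x)) / real N) = (\<lambda>N. 0)" by auto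
    then show False using lim p LIMSEQ_unique[OF tendsto_const] by fastforce
  qed
  then obtain k where "(shift ^^ k) x \<in> cyl n p" by blast
  then show thesis using p that by (metis cyl_eq)
qed

text \<open>
  The lower bound in the Laplace principle: let the first \<open>k\<close> letters follow \<open>x\<close> and the rest vary in a
  cylinder around the \<open>k\<close>-th iterate of \<open>x\<close>. By bounded distortion the exponent is nearly constant
  there, uniformly in \<open>k\<close>. If \<open>\<mu>\<close> charges the cylinder, its Gibbs means have a positive limit, and
  \<open>ln (p b) / b\<close> vanishes.
\<close>

lemma kernel_ge:
  assumes L: "\<And>k. deviation_upto k x \<le> L"
  shows "W (x, y) - V x - L \<le> Vs y + \<gamma>"
proof (rule field_le_epsilon)
  fix e0 :: real assume "0 < e0"
  define e where "e = e0 / 4"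
  have e: "e > 0" using \<open>0 < e0\<close> by (simp add: e_def)
  obtain n1 where n1: "\<And>x z. z \<in> cyl n1 x \<Longrightarrow> \<bar>V z - V x\<bar> < e"
    using continuous_cylE[OF cont_V e] by blast
  obtain n2 where n2: "\<And>x z. z \<in> cyl n2 x \<Longrightarrow> \<bar>W (z, y) - W (x, y)\<bar> < e"
    using continuous_cylE[OF continuous_on_slice(1)[OF cont_W] e] by blast
  obtain n3 where n3: "\<And>k u v. v \<in> cyl (k + n3) u \<Longrightarrow> \<bar>birkhoff A k v - birkhoff A k u\<bar> \<le> e"
    using distortion[OF e] by blast
  define n where "n = max n1 (max n2 n3)"
  then have n: "n1 \<le> n" "n2 \<le> n" "n3 \<le> n" by auto
  obtain k where k: "0 < measure \<mu> (cyl n ((shift ^^ k) x))"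
    using visits_charged_cyl[OF L] by blast
  define C where "C = cyl n ((shift ^^ k) x)"
  define p where "p b = gibbs.mean (\<nu> b) (\<phi> b) (indicator C)" for b
  have "(p \<longlongrightarrow> (\<integral>x. indicator C x \<partial>\<mu>)) at_top"
    unfolding p_def[abs_def]
    by (rule mean_tendsto) (simp add: C_def continuous_on_indicator_clopen)
  then have p: "(p \<longlongrightarrow> measure \<mu> C) at_top"
    using prob_\<mu>(2) sets_eq_imp_space_eq[OF prob_\<mu>(2)] by (simp add: C_def)
  have Cpos: "0 < measure \<mu> C" using k by (simp add: C_def)
  \<comment> \<open>one \<open>e\<close> each for the variation of \<open>V\<close>, of \<open>W\<close> and of the Birkhoff sum, and one for the
    distance of \<open>ln (\<phi> b) / b\<close> from \<open>V\<close>\<close>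
  define c where "c = birkhoff A k x + W (x, y) - V ((shift ^^ k) x) - 4 * e"
  have "c \<le> k * max_mean A + (Vs y + \<gamma>)"
  proof (rule tendsto_le)
    show "((\<lambda>b. k * (pressure b / b) + ln (\<integral>x. exp (b * W (x, y)) \<partial>\<nu> b) / b)
        \<longlongrightarrow> k * max_mean A + (Vs y + \<gamma>)) at_top"
      by (intro tendsto_add tendsto_mult_left pressure_tendsto(1)[OF cont_A \<mu>(1) G] kernel_integral_tendsto)
    have "((\<lambda>b. ln (p b)) \<longlongrightarrow> ln (measure \<mu> C)) at_top"
      using p Cpos by (intro tendsto_ln) auto
    from tendsto_add[OF tendsto_const tendsto_divide_at_top[OF this]]
    show "((\<lambda>b. c + ln (p b) / b) \<longlongrightarrow> c) at_top" by fastforce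
    show "eventually (\<lambda>b. c + ln (p b) / b
        \<le> k * (pressure b / b) + ln (\<integral>x. exp (b * W (x, y)) \<partial>\<nu> b) / b) at_top"
      using eventually_phi_close[OF e] order_tendstoD(1)[OF p Cpos]
    proof eventually_elim
      case (elim b)
      then have b: "b > 0" by blast
      interpret gibbs "\<lambda>x. b * A x" "\<nu> b" "\<phi> b" by (rule G[OF b])
      have "exp (b * c) * mean (indicator C) \<le> eigenvalue ^ k * (\<integral>x. exp (b * W (x, y)) \<partial>\<nu> b)"
      proof (rule integral_ge[OF cont_exp_W])
        show "open C" "closed C" by (simp_all add: C_def)
        fix z assume z: "z \<in> C"
        define w where "w = prepend k x z"
        have w: "w \<in> cyl (k + n) x"
          using z by (auto simp: w_def C_def prepend_def mem_cyl shift_pow_nth)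
        have "w \<in> cyl n2 x" "w \<in> cyl (k + n3) x"
          by (rule subsetD[OF cyl_antimono w]; use n in simp)+
        then have 1: "\<bar>W (w, y) - W (x, y)\<bar> < e" "\<bar>birkhoff A k w - birkhoff A k x\<bar> \<le> e"
          using n2 n3 by auto
        have "z \<in> cyl n1 ((shift ^^ k) x)"
          by (rule subsetD[OF cyl_antimono[OF n(1)] z[unfolded C_def]])
        then have 2: "\<bar>V z - V ((shift ^^ k) x)\<bar> < e" by (rule n1)
        have "exp (b * c) * \<phi> b z \<le> exp (b * c) * exp (b * (V z + e))"
          using elim by (intro mult_left_mono) auto
        also have "\<dots> = exp (b * (c + (V z + e)))"
          by (simp add: exp_add[symmetric] distrib_left)
        also have "\<dots> \<le> exp (b * (birkhoff A k w + W (w, y)))"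
        proof -
          have "c + (V z + e) \<le> birkhoff A k w + W (w, y)"
            using 1 2 by (simp add: c_def abs_le_iff abs_less_iff)
          then show ?thesis using b by simp
        qed
        also have "\<dots> = exp (birkhoff (\<lambda>x. b * A x) k w) * exp (b * W (w, y))"
          by (simp add: birkhoff_scale exp_add[symmetric] distrib_left)
        finally show "exp (b * c) * \<phi> b z
          \<le> exp (birkhoff (\<lambda>x. b * A x) k (prepend k x z)) * exp (b * W (prepend k x z, y))"
          unfolding w_def .
      qed simp
      then have "exp (b * c) * p b \<le> eigenvalue ^ k * (\<integral>x. exp (b * W (x, y)) \<partial>\<nu> b)"
        unfolding p_def .
      moreover have "0 < eigenvalue ^ k * (\<integral>x. exp (b * W (x, y)) \<partial>\<nu> b)"
        using eigenvalue_pos dual_at(3)[OF b] by simp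
      moreover have "0 < exp (b * c) * p b" using elim by simp
      ultimately have "ln (exp (b * c) * p b) \<le> ln (eigenvalue ^ k * (\<integral>x. exp (b * W (x, y)) \<partial>\<nu> b))"
        by simp
      then have "b * c + ln (p b) \<le> k * ln eigenvalue + ln (\<integral>x. exp (b * W (x, y)) \<partial>\<nu> b)"
        using eigenvalue_pos dual_at(3)[OF b] elim by (simp add: ln_mult_pos ln_realpow)
      from divide_right_mono[OF this less_imp_le[OF b]] show ?case
        using b by (simp add: add_divide_distrib)
    qed
  qed simp
  then show "W (x, y) - V x - L \<le> Vs y + \<gamma> + e0"
    using L[of k] by (simp add: c_def e_def deviation_upto_def)
qed

section \<open>Admissibility of the pair of subactions\<close>

definition cost :: "(nat \<Rightarrow> 'a) \<Rightarrow> (nat \<Rightarrow> 'a) \<Rightarrow> ereal"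
  where "cost x y = deviation A V x - ereal (W (x, y)) + ereal \<gamma>"

lemma add_cost: "ereal r + cost x y = ereal (r - W (x, y) + \<gamma>) + deviation A V x"
  by (cases "deviation A V x") (auto simp: cost_def)

text \<open>
  A point \<open>x\<close> that attains the minimum in the admissibility equation for \<open>y\<close>.
\<close>

lemma deviation_attained:
  "\<exists>x. deviation A V x \<le> ereal (W (x, y) - V x - Vs y - \<gamma>)"
proof -
  have "\<exists>z. deviation A V z \<le> ereal (- (Vs y + \<gamma>) - (V z - W (z, y)))"
  proof (rule ex_deviation_le)
    show "continuous_on UNIV (\<lambda>z. V z - W (z, y))"
      by (intro continuous_on_diff cont_V continuous_on_slice(1)[OF cont_W])
    show "\<exists>z. V z - W (z, y) + deviation_upto k z \<le> - (Vs y + \<gamma>)" for k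
      using kernel_le[of k y] by (simp add: algebra_simps)
  qed
  then show ?thesis by (simp add: algebra_simps)
qed

lemma cost_ge: "ereal (- Vs y) \<le> ereal (V x) + cost x y"
proof (cases "deviation A V x")
  case (real r)
  then have "\<And>k. deviation_upto k x \<le> r" using deviation_le_iff[of x r] by simp
  then have "W (x, y) - V x - r \<le> Vs y + \<gamma>" by (rule kernel_ge)
  then show ?thesis unfolding add_cost real by simp
next
  case MInf
  then show ?thesis using deviation_nonneg[of x] by simp
qed (simp add: add_cost)

lemma admissible: "c_admissible cost (\<lambda>x. - V x) (\<lambda>y. - Vs y)"
  unfolding c_admissible_def is_min_of_def
proof (intro conjI allI ballI)
  show "continuous_on UNIV (\<lambda>x. - V x)" by (intro continuous_on_minus cont_V)
  fix y
  show "ereal (- Vs y) \<le> s" if "s \<in> range (\<lambda>x. ereal (- (- V x)) + cost x y)" for s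
    using that cost_ge[of y] by auto
  obtain x where x: "deviation A V x \<le> ereal (W (x, y) - V x - Vs y - \<gamma>)"
    using deviation_attained[of y] by blast
  have "ereal (V x) + cost x y \<le> ereal (- Vs y)"
    unfolding add_cost using add_left_mono[OF x, of "ereal (V x - W (x, y) + \<gamma>)"] by simp
  then have "ereal (- Vs y) = ereal (V x) + cost x y"
    using cost_ge[of y x] by (intro antisym)
  then show "ereal (- Vs y) \<in> range (\<lambda>x. ereal (- (- V x)) + cost x y)" by auto
qed

lemma ex_admissible:
  assumes f: "continuous_on UNIV f"
  shows "\<exists>g. c_admissible cost f g"
proof -
  have "\<exists>L. is_min_of (ereal L) (range (\<lambda>x. ereal (- f x) + cost x y))" for y
  proof -
    obtain x0 r0 where "deviation A V x0 \<le> ereal r0"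
      using deviation_attained[of y] by blast
    moreover have "continuous_on UNIV (\<lambda>x. - f x - W (x, y) + \<gamma>)"
      by (intro continuous_on_add continuous_on_diff continuous_on_minus f
          continuous_on_slice(1)[OF cont_W] continuous_on_const)
    ultimately show ?thesis unfolding add_cost by (intro deviation_min_attained)
  qed
  then have "\<exists>g. \<forall>y. is_min_of (ereal (g y)) (range (\<lambda>x. ereal (- f x) + cost x y))"
    by (intro choice allI)
  then show ?thesis using f by (auto simp: c_admissible_def)
qed

section \<open>Optimality of the pair of subactions\<close>

lemma admissible_le:
  assumes fg: "c_admissible cost f g" and r: "deviation A V x \<le> ereal r"
  shows "g y \<le> - f x - W (x, y) + \<gamma> + r"
proof -
  have "ereal (g y) \<le> ereal (- f x) + cost x y"
    using fg by (auto simp: c_admissible_def is_min_of_def)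
  also have "\<dots> \<le> ereal (- f x - W (x, y) + \<gamma> + r)"
    unfolding add_cost
    using add_left_mono[OF r, of "ereal (- f x - W (x, y) + \<gamma>)"] by simp
  finally show ?thesis by simp
qed

lemma admissible_continuous:
  assumes fg: "c_admissible cost f g"
  shows "continuous_on UNIV g"
proof (rule continuous_of_slices[OF cont_W])
  have le: "g y' \<le> g y + e" if "\<And>x. W (x, y) \<le> W (x, y') + e" for y y' e
  proof -
    obtain x where x: "ereal (g y) = ereal (- f x) + cost x y"
      using fg by (auto simp: c_admissible_def is_min_of_def)
    then obtain r where r: "deviation A V x = ereal r"
      unfolding add_cost by (cases "deviation A V x") auto
    then have "g y = - f x - W (x, y) + \<gamma> + r"
      using x unfolding add_cost by simp
    moreover have "g y' \<le> - f x - W (x, y') + \<gamma> + r"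
      by (rule admissible_le[OF fg]) (simp add: r)
    ultimately show ?thesis using that[of x] by linarith
  qed
  fix y y' e assume W: "\<And>x. \<bar>W (x, y') - W (x, y)\<bar> \<le> e"
  have "W (x, y) \<le> W (x, y') + e" "W (x, y') \<le> W (x, y) + e" for x
    using W[of x] by linarith+
  then have "g y' \<le> g y + e" "g y \<le> g y' + e"
    by (auto intro: le)
  then show "\<bar>g y' - g y\<bar> \<le> e" by (simp add: abs_le_iff)
qed

text \<open>
  Follow \<open>(x, y) \<mapsto> (tau y x, shift y)\<close> from an optimal pair. By the kernel equation the defect in the
  inequality \<open>- Vs y \<le> V x + cost x y\<close> changes in each step by the slack of the dual potential at \<open>y\<close>,
  which is zero, so optimality persists. By the same equation \<open>A\<close> is constant up to a
  telescoping term along the sequence of the \<open>x n\<close>.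
\<close>

lemma backward_orbit:
  assumes y: "\<And>n. dual.slack ((shift ^^ n) y) = 0"
  shows "\<exists>x. (\<forall>n. deviation A V (x n) \<le> ereal (W (x n, (shift ^^ n) y) - V (x n) - Vs ((shift ^^ n) y) - \<gamma>)) \<and>
    (\<forall>h. continuous_on UNIV h \<longrightarrow> (\<lambda>N. (\<Sum>n<N. h (x (Suc n))) / real N) \<longlonglongrightarrow> (\<integral>x. h x \<partial>\<mu>))"
proof -
  define yn where "yn n = (shift ^^ n) y" for n
  have yn_Suc: "shift (yn n) = yn (Suc n)" for n by (simp add: yn_def)
  obtain x0 where x0: "deviation A V x0 \<le> ereal (W (x0, y) - V x0 - Vs y - \<gamma>)"
    using deviation_attained by blast
  define x where "x = rec_nat x0 (\<lambda>n. tau (yn n))"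
  have x_0: "x 0 = x0" and x_Suc: "x (Suc n) = tau (yn n) (x n)" for n
    by (simp_all add: x_def)
  have shift_x: "shift (x (Suc n)) = x n" for n by (simp add: x_Suc)
  have kernel: "As (yn n) = A (x (Suc n)) + W (x (Suc n), yn (Suc n)) - W (x n, yn n)" for n
    using dual_potential_eq[OF W, of "yn n" "x n"] by (simp add: x_Suc yn_Suc)
  have tight: "As (yn n) = Vs (yn (Suc n)) - Vs (yn n) + max_mean A" for n
    using y[of n] by (simp add: dual.slack_def max_mean_dual yn_def)
  have "deviation A V (x n) \<le> ereal (W (x n, yn n) - V (x n) - Vs (yn n) - \<gamma>)" for n
  proof (induction n)
    case 0
    then show ?case using x0 by (simp add: x_0 yn_def)
  next
    case (Suc n)
    then have "deviation A V (shift (x (Suc n))) \<le> ereal (W (x n, yn n) - V (x n) - Vs (yn n) - \<gamma>)"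
      by (simp add: shift_x)
    from deviation_le_preimage[OF this]
    have "deviation A V (x (Suc n)) \<le> ereal (slack (x (Suc n)) + (W (x n, yn n) - V (x n) - Vs (yn n) - \<gamma>))" .
    also have "slack (x (Suc n)) + (W (x n, yn n) - V (x n) - Vs (yn n) - \<gamma>)
        = W (x (Suc n), yn (Suc n)) - V (x (Suc n)) - Vs (yn (Suc n)) - \<gamma>"
      using kernel[of n] tight[of n] by (simp add: slack_def shift_x)
    finally show ?case .
  qed
  moreover have "(\<lambda>N. (\<Sum>n<N. h (x (Suc n))) / real N) \<longlonglongrightarrow> (\<integral>x. h x \<partial>\<mu>)"
    if h: "continuous_on UNIV h" for h
  proof (rule equidistribution[OF cont_A h \<mu>(2)])
    fix f :: "(nat \<Rightarrow> 'a) \<Rightarrow> real" assume "continuous_on UNIV f"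
    then obtain K where K: "\<And>x. \<bar>f x\<bar> \<le> K" using continuous_abs_bound by blast
    have "(\<Sum>n<N. f (shift (x (Suc n))) - f (x (Suc n))) = f (x 0) - f (x N)" for N
      unfolding shift_x by (rule sum_lessThan_telescope')
    then have "\<bar>\<Sum>n<N. f (shift (x (Suc n))) - f (x (Suc n))\<bar> \<le> 2 * K" for N
      using K[of "x 0"] K[of "x N"] by simp
    then show "\<exists>K. \<forall>N. \<bar>\<Sum>n<N. f (shift (x (Suc n))) - f (x (Suc n))\<bar> \<le> K" by blast
  next
    define q where "q n = Vs (yn n) - W (x n, yn n)" for n
    obtain K1 where K1: "\<And>x. \<bar>Vs x\<bar> \<le> K1" using continuous_abs_bound[OF dual.cont_V] by blast
    have "bounded (range W)"
      using compact_continuous_image[OF cont_W] compact_Times[OF compact_UNIV_shift_space compact_UNIV_shift_space]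
      by (intro compact_imp_bounded) simp
    then obtain K2 where K2: "\<And>p. \<bar>W p\<bar> \<le> K2" by (auto simp: bounded_iff)
    have "A (x (Suc n)) = q (Suc n) - q n + max_mean A" for n
      using kernel[of n] tight[of n] by (simp add: q_def)
    then have sum: "(\<Sum>n<N. A (x (Suc n))) - real N * max_mean A = q N - q 0" for N
      by (simp add: sum.distrib sum_lessThan_telescope)
    have q: "\<bar>q n\<bar> \<le> K1 + K2" for n
      using K1[of "yn n"] K2[of "(x n, yn n)"] by (simp add: q_def)
    have "\<bar>(\<Sum>n<N. A (x (Suc n))) - real N * max_mean A\<bar> \<le> 2 * (K1 + K2)" for N
      unfolding sum using q[of N] q[of 0] abs_triangle_ineq4[of "q N" "q 0"] by simp
    then show "\<exists>K. \<forall>N. \<bar>(\<Sum>n<N. A (x (Suc n))) - real N * max_mean A\<bar> \<le> K" by blast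
  qed
  ultimately show ?thesis unfolding yn_def by blast
qed

lemma inv_\<mu>s: "invariant_prob \<mu>s" and prob_\<mu>s: "prob_space \<mu>s" "sets \<mu>s = sets borel"
  using \<mu>s by (auto simp: maximizing_def invariant_prob_def)

lemma integral_shift_pow:
  fixes h :: "(nat \<Rightarrow> 'a) \<Rightarrow> real"
  assumes "continuous_on UNIV h"
  shows "(\<integral>y. h ((shift ^^ n) y) \<partial>\<mu>s) = (\<integral>y. h y \<partial>\<mu>s)"
  using assms
proof (induction n arbitrary: h)
  case (Suc n)
  have "(\<integral>y. h ((shift ^^ Suc n) y) \<partial>\<mu>s) = (\<integral>y. h (shift y) \<partial>\<mu>s)"
    using Suc.IH[OF continuous_comp(1)[OF Suc.prems]] by simp
  also have "\<dots> = (\<integral>y. h y \<partial>\<mu>s)" by (rule invariant_prob_integral_shift[OF inv_\<mu>s Suc.prems])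
  finally show ?case .
qed simp

text \<open>
  The slack is nonnegative and has integral zero for a maximizing probability.
\<close>

lemma AE_dual_slack_zero: "AE y in \<mu>s. \<forall>n. dual.slack ((shift ^^ n) y) = 0"
  unfolding AE_all_countable
proof
  fix n
  note st = invariant_prob_state[OF inv_\<mu>s]
  note c = dual.cont_V continuous_comp(1)[OF dual.cont_V] cont_As
  have "(\<integral>y. dual.slack y \<partial>\<mu>s)
      = (\<integral>y. (Vs (shift y) - Vs y - As y) + max_mean As \<partial>\<mu>s)"
    by (simp add: dual.slack_def)
  also have "\<dots> = (\<integral>y. Vs (shift y) - Vs y - As y \<partial>\<mu>s) + max_mean As"
    by (subst state_add[OF st]) (auto intro!: continuous_on_diff c simp: prob_space.prob_space[OF prob_\<mu>s(1)])
  also have "(\<integral>y. Vs (shift y) - Vs y - As y \<partial>\<mu>s) = (\<integral>y. Vs (shift y) - Vs y \<partial>\<mu>s) - (\<integral>y. As y \<partial>\<mu>s)"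
    by (intro state_diff[OF st] continuous_on_diff c)
  also have "(\<integral>y. Vs (shift y) - Vs y \<partial>\<mu>s) = 0"
    by (subst state_diff[OF st]) (auto intro!: c simp: invariant_prob_integral_shift[OF inv_\<mu>s dual.cont_V])
  finally have "(\<integral>y. dual.slack y \<partial>\<mu>s) = 0"
    using \<mu>s by (simp add: maximizing_def)
  then have "(\<integral>y. dual.slack ((shift ^^ n) y) \<partial>\<mu>s) = 0"
    by (simp add: integral_shift_pow[OF dual.cont_slack])
  then show "AE y in \<mu>s. dual.slack ((shift ^^ n) y) = 0"
    by (subst (asm) integral_nonneg_eq_0_iff_AE)
      (auto simp: dual.slack_nonneg intro: integrable_continuous[OF prob_\<mu>s continuous_comp(3)[OF dual.cont_slack]])
qed

text \<open>
  The inequality is obtained on average along the orbits of \<open>backward_orbit\<close>. The positive part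
  \<open>u N\<close> of the excess of the \<open>N\<close>-th average over its asymptotic bound \<open>- k\<close> tends to zero almost surely, hence in mean, while the
  mean of the average does not depend on \<open>N\<close> by invariance.
\<close>

lemma duality_bound:
  assumes fg: "c_admissible cost f g"
  shows "(\<integral>x. f x + V x \<partial>\<mu>) + (\<integral>y. g y + Vs y \<partial>\<mu>s) \<le> 0"
proof -
  define K where "K x = f x + V x" for x
  define H where "H y = g y + Vs y" for y
  define k where "k = (\<integral>x. K x \<partial>\<mu>)"
  have cK: "continuous_on UNIV K"
    using fg unfolding K_def by (intro continuous_on_add cont_V) (simp add: c_admissible_def)
  have cH: "continuous_on UNIV H"
    unfolding H_def by (intro continuous_on_add dual.cont_V admissible_continuous[OF fg])
  define a where "a N y = (\<Sum>n<N. H ((shift ^^ Suc n) y)) / real N" for N y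
  define u where "u N y = max 0 (a N y + k)" for N y
  have ca: "continuous_on UNIV (a N)" for N
    unfolding a_def divide_inverse
    by (intro continuous_on_mult continuous_on_sum continuous_on_const continuous_comp(3)[OF cH])
  have cu: "continuous_on UNIV (u N)" for N
    unfolding u_def by (intro continuous_on_max continuous_on_add continuous_on_const ca)
  obtain M where M: "\<And>y. \<bar>H y\<bar> \<le> M" using continuous_abs_bound[OF cH] by blast
  have "M \<ge> 0" using M[of undefined] by linarith
  have aM: "\<bar>a N y\<bar> \<le> M" for N y
  proof (cases "N = 0")
    case False
    have "\<bar>\<Sum>n<N. H ((shift ^^ Suc n) y)\<bar> \<le> (\<Sum>n<N. \<bar>H ((shift ^^ Suc n) y)\<bar>)" by (rule sum_abs)
    also have "\<dots> \<le> (\<Sum>n<N. M)" by (intro sum_mono M)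
    finally show ?thesis using False by (simp add: a_def field_simps del: funpow.simps)
  qed (simp add: a_def \<open>M \<ge> 0\<close>)
  have lim: "AE y in \<mu>s. (\<lambda>N. u N y) \<longlonglongrightarrow> 0"
    using AE_dual_slack_zero
  proof eventually_elim
    case (elim y)
    then obtain x where
      x: "\<And>n. deviation A V (x n) \<le> ereal (W (x n, (shift ^^ n) y) - V (x n) - Vs ((shift ^^ n) y) - \<gamma>)"
      and eq: "\<And>h. continuous_on UNIV h \<Longrightarrow>
        (\<lambda>N. (\<Sum>n<N. h (x (Suc n))) / real N) \<longlonglongrightarrow> (\<integral>x. h x \<partial>\<mu>)"
      using backward_orbit[of y] by blast
    have HK: "H ((shift ^^ n) y) \<le> - K (x n)" for n
      using admissible_le[OF fg x[of n], of "(shift ^^ n) y"] by (simp add: H_def K_def)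
    have le: "u N y \<le> max 0 (k - (\<Sum>n<N. K (x (Suc n))) / real N)" for N
    proof -
      have "(\<Sum>n<N. H ((shift ^^ Suc n) y)) \<le> (\<Sum>n<N. - K (x (Suc n)))"
        by (intro sum_mono HK)
      then have "a N y \<le> (\<Sum>n<N. - K (x (Suc n))) / real N"
        unfolding a_def by (intro divide_right_mono) auto
      then show ?thesis by (auto simp: u_def sum_negf)
    qed
    have "(\<lambda>N. max 0 (k - (\<Sum>n<N. K (x (Suc n))) / real N)) \<longlonglongrightarrow> max 0 (k - k)"
      unfolding k_def by (rule tendsto_max[OF tendsto_const tendsto_diff[OF tendsto_const eq[OF cK]]])
    then have lim_K: "(\<lambda>N. max 0 (k - (\<Sum>n<N. K (x (Suc n))) / real N)) \<longlonglongrightarrow> 0" by simp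
    show ?case
      by (rule tendsto_sandwich[OF always_eventually always_eventually tendsto_const lim_K])
        (use le in \<open>simp_all add: u_def\<close>)
  qed
  have meas: "h \<in> borel_measurable \<mu>s" if "continuous_on UNIV h" for h :: "(nat \<Rightarrow> 'a) \<Rightarrow> real"
    using integrable_continuous[OF prob_\<mu>s that] by (rule borel_measurable_integrable)
  have "(\<lambda>N. \<integral>y. u N y \<partial>\<mu>s) \<longlonglongrightarrow> (\<integral>y. 0 \<partial>\<mu>s)"
  proof (rule integral_dominated_convergence[where w = "\<lambda>_. M + \<bar>k\<bar>"])
    show "u N \<in> borel_measurable \<mu>s" for N by (rule meas[OF cu])
    show "integrable \<mu>s (\<lambda>_. M + \<bar>k\<bar>)"
      by (rule integrable_continuous[OF prob_\<mu>s continuous_on_const])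
    have "\<bar>u N y\<bar> \<le> M + \<bar>k\<bar>" for N y
      using aM[of N y] unfolding u_def by linarith
    then show "AE y in \<mu>s. norm (u N y) \<le> M + \<bar>k\<bar>" for N by simp
  qed (use lim in auto)
  then have lim0: "(\<lambda>N. \<integral>y. u N y \<partial>\<mu>s) \<longlonglongrightarrow> 0" by simp
  have "(\<integral>y. H y \<partial>\<mu>s) + k \<le> (\<integral>y. u N y \<partial>\<mu>s)" if N: "N \<ge> 1" for N
  proof -
    note st = invariant_prob_state[OF inv_\<mu>s]
    have "(\<integral>y. a N y \<partial>\<mu>s) = (\<integral>y. (\<Sum>n<N. H ((shift ^^ Suc n) y)) \<partial>\<mu>s) / real N"
      unfolding a_def by simp
    also have "(\<integral>y. (\<Sum>n<N. H ((shift ^^ Suc n) y)) \<partial>\<mu>s) = (\<Sum>n<N. \<integral>y. H ((shift ^^ Suc n) y) \<partial>\<mu>s)"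
      by (rule state_sum[OF st]) (rule continuous_comp(3)[OF cH])
    also have "\<dots> = real N * (\<integral>y. H y \<partial>\<mu>s)"
      by (simp only: integral_shift_pow[OF cH]) simp
    finally have "(\<integral>y. H y \<partial>\<mu>s) + k = (\<integral>y. a N y + k \<partial>\<mu>s)"
      using N state_add[OF st ca continuous_on_const] by (simp add: prob_space.prob_space[OF prob_\<mu>s(1)])
    also have "\<dots> \<le> (\<integral>y. u N y \<partial>\<mu>s)"
      by (rule state_mono[OF st continuous_on_add[OF ca continuous_on_const] cu]) (simp add: u_def)
    finally show ?thesis .
  qed
  then have "(\<integral>y. H y \<partial>\<mu>s) + k \<le> 0"
    by (intro LIMSEQ_le_const[OF lim0]) blast
  then show ?thesis unfolding k_def K_def H_def by simp
qed

lemma optimal: "optimal_pair cost \<mu> \<mu>s (\<lambda>x. - V x) (\<lambda>y. - Vs y)"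
  unfolding optimal_pair_def
proof (intro conjI allI impI admissible)
  fix f g assume fg: "c_admissible cost f g"
  have f: "continuous_on UNIV f" using fg by (simp add: c_admissible_def)
  have "(\<integral>x. f x + V x \<partial>\<mu>) = (\<integral>x. f x \<partial>\<mu>) + (\<integral>x. V x \<partial>\<mu>)"
    by (rule state_add[OF invariant_prob_state[OF prob_\<mu>(3)] f cont_V])
  moreover have "(\<integral>y. g y + Vs y \<partial>\<mu>s) = (\<integral>y. g y \<partial>\<mu>s) + (\<integral>y. Vs y \<partial>\<mu>s)"
    by (rule state_add[OF invariant_prob_state[OF inv_\<mu>s] admissible_continuous[OF fg] dual.cont_V])
  ultimately show "(\<integral>x. f x \<partial>\<mu>) + (\<integral>y. g y \<partial>\<mu>s) \<le> (\<integral>x. - V x \<partial>\<mu>) + (\<integral>y. - Vs y \<partial>\<mu>s)"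
    using duality_bound[OF fg] by simp
qed

end

theorem theorem2:
  fixes lam \<gamma> :: real
    and A Astar V Vstar :: "(nat \<Rightarrow> 'a::{finite,discrete_topology}) \<Rightarrow> real"
    and W :: "(nat \<Rightarrow> 'a) \<times> (nat \<Rightarrow> 'a) \<Rightarrow> real"
    and \<mu> \<mu>star :: "(nat \<Rightarrow> 'a) measure"
    and \<nu> \<nu>star :: "real \<Rightarrow> (nat \<Rightarrow> 'a) measure"
    and \<phi> \<phi>star :: "real \<Rightarrow> (nat \<Rightarrow> 'a) \<Rightarrow> real"
    and c :: "(nat \<Rightarrow> 'a) \<Rightarrow> (nat \<Rightarrow> 'a) \<Rightarrow> ereal"
  assumes lam: "0 < lam" "lam < 1"
    and A: "hoelder (shift_dist lam) A"
    and \<mu>: "maximizing A \<mu>" "\<And>\<mu>'. maximizing A \<mu>' \<Longrightarrow> \<mu>' = \<mu>"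
    and W: "hoelder (shift_dist2 lam) W" "involution_kernel A W"
    and Astar: "Astar = dual_potential A W"
    and \<mu>star: "maximizing Astar \<mu>star"
    and \<nu>: "\<And>\<beta>. \<beta> > 0 \<Longrightarrow> eigenprobability (\<lambda>x. \<beta> * A x) (\<nu> \<beta>)"
    and \<phi>: "\<And>\<beta>. \<beta> > 0 \<Longrightarrow> normalized_eigenfunction (\<lambda>x. \<beta> * A x) (\<nu> \<beta>) (\<phi> \<beta>)"
    and \<nu>star: "\<And>\<beta>. \<beta> > 0 \<Longrightarrow> eigenprobability (\<lambda>y. \<beta> * Astar y) (\<nu>star \<beta>)"
    and \<phi>star: "\<And>\<beta>. \<beta> > 0 \<Longrightarrow>
      normalized_eigenfunction (\<lambda>y. \<beta> * Astar y) (\<nu>star \<beta>) (\<phi>star \<beta>)"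
    and V: "uniform_limit UNIV (\<lambda>\<beta> x. 1 / \<beta> * ln (\<phi> \<beta> x)) V at_top"
    and Vstar: "uniform_limit UNIV (\<lambda>\<beta> y. 1 / \<beta> * ln (\<phi>star \<beta> y)) Vstar at_top"
    and \<gamma>: "((\<lambda>\<beta>. 1 / \<beta> * ln (\<integral>y. (\<integral>x. exp (\<beta> * W (x, y)) \<partial>\<nu> \<beta>) \<partial>\<nu>star \<beta>))
      \<longlongrightarrow> \<gamma>) at_top"
    and c: "\<And>x y. c x y = deviation A V x - ereal (W (x, y)) + ereal \<gamma>"
  shows "optimal_pair c \<mu> \<mu>star (\<lambda>x. - V x) (\<lambda>y. - Vstar y) \<and>
    (\<forall>f. continuous_on UNIV f \<longrightarrow> (\<exists>fs. c_admissible c f fs))"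
proof -
  have contA: "continuous_on UNIV A"
    by (rule hoelder_continuous[OF lam A])
  have contAs: "continuous_on UNIV Astar"
    unfolding Astar by (rule continuous_on_dual_potential[OF contA W(2)])
  interpret zero_temperature A V Vstar W \<mu> \<mu>star \<nu> \<nu>star \<phi> \<phi>star \<gamma>
  proof (rule zero_temperature.intro)
    show "\<exists>n. \<forall>k u v. v \<in> cyl (k + n) u \<longrightarrow> \<bar>birkhoff A k v - birkhoff A k u\<bar> \<le> e" if "e > 0" for e
      by (rule hoelder_distortion[OF lam A that])
    show "gibbs (\<lambda>x. b * A x) (\<nu> b) (\<phi> b)" if "b > 0" for b
      by (intro gibbs.intro continuous_on_mult continuous_on_const contA \<nu>[OF that] \<phi>[OF that])
    show "gibbs (\<lambda>y. b * dual_potential A W y) (\<nu>star b) (\<phi>star b)" if "b > 0" for b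
      unfolding Astar[symmetric]
      by (intro gibbs.intro continuous_on_mult continuous_on_const contAs \<nu>star[OF that] \<phi>star[OF that])
    show "maximizing (dual_potential A W) \<mu>star"
      using \<mu>star unfolding Astar .
  qed (fact contA \<mu> W(2) V Vstar \<gamma>)+
  have "c = cost"
    by (intro ext) (simp only: c cost_def)
  then show ?thesis
    using optimal ex_admissible by simp
qed

end
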